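(* Let $n\ge 2$ and let $\boldsymbol X=(X_1,\dots,X_n)$ and $\boldsymbol Y=(Y_1,\dots,Y_n)$ be two nonnegative random vectors with joint distribution functions $F$ and $G$, joint densities, marginal distribution functions $F_1,\dots,F_n$ and $G_1,\dots,G_n$ that are continuous and have finite expectations, and copulas $C$ and $C'$, respectively. Suppose that $C\le_{\rm whr}C'$, and that either $(X_2,\dots,X_n)\uparrow_{\rm SI}X_1$ or $(Y_2,\dots,Y_n)\uparrow_{\rm SI}Y_1$ holds. Then, for every $\boldsymbol p=(p_1,\dots,p_n)\in(0,1)^n$, $X_1\le_{\rm ps}Y_1$ implies that $$\Delta^{\rm R}{\rm MCoES}_{\boldsymbol p}[X_1|X_2,\dots,X_n]\le \Delta^{\rm R}{\rm MCoES}_{\boldsymbol p}[Y_1|Y_2,\dots,Y_n].$$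
   Context: Throughout, "increasing" means nondecreasing. Value-at-Risk and Expected Shortfall: for a random variable $X$ with distribution function $F_X$ and $p\in(0,1)$, ${\rm VaR}_p[X]=F_X^{-1}(p)=\inf\{x\in\mathbb R: F_X(x)\ge p\}$ and ${\rm ES}_p[X]=\frac1{1-p}\int_p^1{\rm VaR}_t[X]\,dt$; the VaR of a conditional random variable is the quantile of its conditional distribution. Multivariate CoVaR and CoES: for $\boldsymbol p=(p_1,\dots,p_n)\in(0,1)^n$, ${\rm MCoVaR}_{\boldsymbol p}[X_1|X_2,\dots,X_n]={\rm VaR}_{p_1}\big[X_1\,\big|\,\bigcap_{j=2}^n\{X_j>{\rm VaR}_{p_j}[X_j]\}\big]$ (the conditioning event is assumed to have positive probability whenever this is written), and ${\rm MCoES}_{\boldsymbol p}[X_1|X_2,\dots,X_n]=\frac1{1-p_1}\int_{p_1}^1{\rm MCoVaR}_{t,p_2,\dots,p_n}[X_1|X_2,\dots,X_n]\,dt$. Ratio-based contribution: $\Delta^{\rm R}{\rm MCoES}_{\boldsymbol p}[X_1|X_2,\dots,X_n]=\dfrac{{\rm MCoES}_{\boldsymbol p}[X_1|X_2,\dots,X_n]-{\rm ES}_{p_1}[X_1]}{{\rm ES}_{p_1}[X_1]}$, defined when ${\rm ES}_{p_1}[X_1]\ne 0$. The same definitions apply to $\boldsymbol Y$. Copula: the copula $C$ of $\boldsymbol X$ is the joint distribution function on $[0,1]^n$ of $(U_1,\dots,U_n)$ with $U_i=F_i(X_i)$, so $F(x_1,\dots,x_n)=C(F_1(x_1),\dots,F_n(x_n))$.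 Its joint tail function is $\overline C(p_1,\dots,p_n)=\mathbb P(U_1>p_1,\dots,U_n>p_n)$. Similarly $C'$, $\overline{C'}$ for $\boldsymbol Y$ with $G_i(Y_i)$. Weak multivariate hazard rate order for copulas: $C\le_{\rm whr}C'$ means that $\overline{C'}(\boldsymbol p)/\overline C(\boldsymbol p)$ is increasing in $\boldsymbol p$ (componentwise) on $\{\boldsymbol p\in[0,1]^n:\overline C(\boldsymbol p)>0\}$. Stochastic increasingness: $(X_2,\dots,X_n)\uparrow_{\rm SI}X_1$ means that the conditional distribution of $(X_2,\dots,X_n)$ given $X_1=x_1$ is increasing in $x_1$ in the multivariate usual stochastic order, i.e. $\mathbb E[\phi(X_2,\dots,X_n)\mid X_1=x_1]$ is increasing in $x_1$ for every bounded (componentwise) increasing $\phi:\mathbb R^{n-1}\to\mathbb R$. Expected proportional shortfall order: for nonnegative random variables $X,Y$, $X\le_{\rm ps}Y$ means ${\rm EPS}_p(X)\le{\rm EPS}_p(Y)$ for all $p\in D_X\cap D_Y$, where $D_X=\{p\in(0,1):F_X^{-1}(p)>0\}$, $D_Y=\{p\in(0,1):F_Y^{-1}(p)>0\}$ and ${\rm EPS}_p(X)=\mathbb E\Big[\Big(\frac{X-{\rm VaR}_p[X]}{{\rm VaR}_p[X]}\Big)_+\Big]$, with $x_+=\max(0,x)$. *)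

theory Defs
  imports "HOL-Probability.Probability"
begin

text \<open>
  A random vector \<open>(X\<^sub>1, \<dots>, X\<^sub>n)\<close> on a probability space \<open>M\<close> is a family
  \<open>X :: nat \<Rightarrow> 'a \<Rightarrow> real\<close> of which only the components with index in \<open>{1..n}\<close> are used;
  likewise for points of \<open>\<real>\<^sup>n\<close>.
\<close>

definition rvec :: "nat set \<Rightarrow> (nat \<Rightarrow> 'a \<Rightarrow> real) \<Rightarrow> 'a \<Rightarrow> nat \<Rightarrow> real" where
  "rvec I X \<omega> = (\<lambda>i\<in>I. X i \<omega>)"

definition dist_fun :: "'a measure \<Rightarrow> ('a \<Rightarrow> real) \<Rightarrow> real \<Rightarrow> real" where
  "dist_fun M X = cdf (distr M borel X)"

definition VaR :: "'a measure \<Rightarrow> ('a \<Rightarrow> real) \<Rightarrow> real \<Rightarrow> real" where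
  "VaR M X p = Inf {x. dist_fun M X x \<ge> p}"

definition ES :: "'a measure \<Rightarrow> ('a \<Rightarrow> real) \<Rightarrow> real \<Rightarrow> real" where
  "ES M X p = 1 / (1 - p) * (LBINT t:{p<..<1}. VaR M X t)"

definition stress_event :: "nat \<Rightarrow> 'a measure \<Rightarrow> (nat \<Rightarrow> 'a \<Rightarrow> real) \<Rightarrow> (nat \<Rightarrow> real) \<Rightarrow> 'a set" where
  "stress_event n M X p = {\<omega> \<in> space M. \<forall>j\<in>{2..n}. X j \<omega> > VaR M (X j) (p j)}"

text \<open>
  For an event \<open>A\<close> of positive probability, \<open>uniform_measure M A\<close> is the conditional
  probability measure given \<open>A\<close>.  It is meaningless when \<open>A\<close> is null.
\<close>

definition MCoVaR :: "nat \<Rightarrow> 'a measure \<Rightarrow> (nat \<Rightarrow> 'a \<Rightarrow> real) \<Rightarrow> (nat \<Rightarrow> real) \<Rightarrow> real" where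
  "MCoVaR n M X p = VaR (uniform_measure M (stress_event n M X p)) (X 1) (p 1)"

definition MCoES :: "nat \<Rightarrow> 'a measure \<Rightarrow> (nat \<Rightarrow> 'a \<Rightarrow> real) \<Rightarrow> (nat \<Rightarrow> real) \<Rightarrow> real" where
  "MCoES n M X p = 1 / (1 - p 1) * (LBINT t:{p 1<..<1}. MCoVaR n M X (p(1 := t)))"

definition Delta_R_MCoES ::
    "nat \<Rightarrow> 'a measure \<Rightarrow> (nat \<Rightarrow> 'a \<Rightarrow> real) \<Rightarrow> (nat \<Rightarrow> real) \<Rightarrow> real" where
  "Delta_R_MCoES n M X p = (MCoES n M X p - ES M (X 1) (p 1)) / ES M (X 1) (p 1)"

text \<open>
  The copula of \<open>X\<close> is represented by the probability law on \<open>[0,1]\<^sup>n\<close> of which it is the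
  joint distribution function, namely the law of \<open>(F\<^sub>1(X\<^sub>1), \<dots>, F\<^sub>n(X\<^sub>n))\<close>.
\<close>

definition copula :: "nat \<Rightarrow> 'a measure \<Rightarrow> (nat \<Rightarrow> 'a \<Rightarrow> real) \<Rightarrow> (nat \<Rightarrow> real) measure" where
  "copula n M X =
     distr M (PiM {1..n} (\<lambda>_. borel)) (rvec {1..n} (\<lambda>i \<omega>. dist_fun M (X i) (X i \<omega>)))"

definition joint_tail :: "nat \<Rightarrow> (nat \<Rightarrow> real) measure \<Rightarrow> (nat \<Rightarrow> real) \<Rightarrow> real" where
  "joint_tail n C p = measure C {u \<in> space C. \<forall>i\<in>{1..n}. u i > p i}"

definition whr_le :: "nat \<Rightarrow> (nat \<Rightarrow> real) measure \<Rightarrow> (nat \<Rightarrow> real) measure \<Rightarrow> bool" where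
  "whr_le n C C' \<longleftrightarrow>
     (\<forall>p q. (\<forall>i\<in>{1..n}. 0 \<le> p i \<and> p i \<le> q i \<and> q i \<le> 1) \<and>
            joint_tail n C p > 0 \<and> joint_tail n C q > 0 \<longrightarrow>
            joint_tail n C' p / joint_tail n C p \<le> joint_tail n C' q / joint_tail n C q)"

text \<open>
  Stochastic increasingness of \<open>(X\<^sub>2, \<dots>, X\<^sub>n)\<close> in \<open>X\<^sub>1\<close>.  The function
  \<open>x \<mapsto> E[\<phi>(X\<^sub>2, \<dots>, X\<^sub>n) | X\<^sub>1 = x]\<close> is determined only up to null sets of the law of \<open>X\<^sub>1\<close>, so
  the requirement is that it has an increasing version \<open>h\<close>.  Componentwise increasing functions
  need not be Borel, hence the measurability condition on \<open>\<phi>\<close>.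
\<close>

definition SI_in_first :: "nat \<Rightarrow> 'a measure \<Rightarrow> (nat \<Rightarrow> 'a \<Rightarrow> real) \<Rightarrow> bool" where
  "SI_in_first n M X \<longleftrightarrow>
     (\<forall>\<phi> \<in> borel_measurable (PiM {2..n} (\<lambda>_. borel :: real measure)).
        bounded (\<phi> ` ({2..n} \<rightarrow>\<^sub>E UNIV)) \<and>
        (\<forall>x \<in> {2..n} \<rightarrow>\<^sub>E UNIV. \<forall>y \<in> {2..n} \<rightarrow>\<^sub>E UNIV.
           (\<forall>i\<in>{2..n}. x i \<le> y i) \<longrightarrow> \<phi> x \<le> \<phi> y) \<longrightarrow>
        (\<exists>h :: real \<Rightarrow> real. mono h \<and>
           (AE \<omega> in M.
              real_cond_exp M (vimage_algebra (space M) (X 1) borel)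
                (\<lambda>\<omega>. \<phi> (rvec {2..n} X \<omega>)) \<omega> = h (X 1 \<omega>))))"

definition EPS :: "'a measure \<Rightarrow> ('a \<Rightarrow> real) \<Rightarrow> real \<Rightarrow> real" where
  "EPS M X p = (LINT \<omega>|M. max 0 ((X \<omega> - VaR M X p) / VaR M X p))"

definition ps_le :: "'a measure \<Rightarrow> ('a \<Rightarrow> real) \<Rightarrow> 'b measure \<Rightarrow> ('b \<Rightarrow> real) \<Rightarrow> bool" where
  "ps_le M X N Y \<longleftrightarrow>
     (\<forall>p \<in> {p \<in> {0<..<1}. VaR M X p > 0} \<inter> {p \<in> {0<..<1}. VaR N Y p > 0}.
        EPS M X p \<le> EPS N Y p)"

end

theory Submission imports Defs begin

text \<open>
  With \<open>U = F\<^sub>1(X\<^sub>1)\<close> and \<open>V = G\<^sub>1(Y\<^sub>1)\<close>, conditioning on the stress events replaces the uniform laws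
  of \<open>U\<close> and \<open>V\<close> by laws \<open>\<mu>\<close> and \<open>\<nu>\<close> on \<open>(0, 1)\<close>, and MCoES becomes the expected shortfall of the
  marginal quantile function under \<open>\<mu>\<close> or \<open>\<nu>\<close>.  The weak hazard rate order, applied between \<open>p\<^sub>1 = 0\<close>
  and \<open>p\<^sub>1 = u\<close>, says that \<open>\<mu>\<close> is stochastically smaller than \<open>\<nu>\<close>; hence, for each of the two quantile
  functions, the expected shortfall under \<open>\<mu>\<close> is at most that under \<open>\<nu>\<close>.  It remains to compare
  the two quantile functions under a single law, \<open>\<mu>\<close> or \<open>\<nu>\<close>, for which stochastic increasingness gives an
  increasing density \<open>k\<close>.  The order \<open>\<le>\<^sub>p\<^sub>s\<close> means that the hazard-like ratio
  \<open>F\<^sub>1\<^sup>-\<^sup>1(t) / \<integral>\<^sub>t\<^sup>1 F\<^sub>1\<^sup>-\<^sup>1\<close> dominates that of \<open>G\<^sub>1\<close>, so that \<open>\<integral>\<^sub>s\<^sup>1 G\<^sub>1\<^sup>-\<^sup>1 / \<integral>\<^sub>s\<^sup>1 F\<^sub>1\<^sup>-\<^sup>1\<close> increases in \<open>s\<close>;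
  the increasing weight \<open>k\<close>, cut off below its \<open>p\<^sub>1\<close>-quantile, is a mixture of the indicators of the
  intervals \<open>(s, 1)\<close> with \<open>s \<ge> p\<^sub>1\<close>, and the comparison of tails passes to it.
\<close>

section \<open>Quantiles and expected shortfall\<close>

text \<open>A measure on all of the reals, carried by (0, 1), so that it can be equated with image
  laws of the form \<open>distr M borel U\<close>.\<close>

definition unit_unif :: "real measure" where
  "unit_unif = density lborel (\<lambda>t. ennreal (indicator {0<..<1} t))"

lemma space_unit_unif [simp]: "space unit_unif = UNIV"
  and sets_unit_unif [simp, measurable_cong]: "sets unit_unif = sets borel"
  by (auto simp: unit_unif_def)

lemma nn_integral_unit_unif:
  assumes [measurable]: "f \<in> borel_measurable borel"
  shows "(\<integral>\<^sup>+ t. f t \<partial>unit_unif) = (\<integral>\<^sup>+ t. f t * indicator {0<..<1} t \<partial>lborel)"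
  unfolding unit_unif_def
  by (subst nn_integral_density) (auto intro!: nn_integral_cong simp: mult.commute ennreal_indicator)

lemma prob_space_unit_unif: "prob_space unit_unif"
proof
  have "emeasure unit_unif (space unit_unif) = (\<integral>\<^sup>+ t. 1 \<partial>unit_unif)"
    by simp
  also have "\<dots> = 1"
    by (subst nn_integral_unit_unif) auto
  finally show "emeasure unit_unif (space unit_unif) = 1" .
qed

lemma AE_unit_unif_iff: "(AE t in unit_unif. P t) \<longleftrightarrow> (AE t in lborel. 0 < t \<and> t < 1 \<longrightarrow> P t)"
  unfolding unit_unif_def by (subst AE_density) (auto simp: indicator_def cong: AE_cong)

lemma AE_unit_unif_in: "AE t in unit_unif. 0 < t \<and> t < 1"
  by (simp add: AE_unit_unif_iff)

lemma AE_unit_unif_neq: "AE t in unit_unif. t \<noteq> c"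
  unfolding AE_unit_unif_iff using AE_lborel_singleton[of c] by auto

lemma integral_unit_unif:
  fixes f :: "real \<Rightarrow> real"
  assumes [measurable]: "f \<in> borel_measurable borel"
  shows "integral\<^sup>L unit_unif f = (\<integral>t. indicator {0<..<1} t * f t \<partial>lborel)"
  unfolding unit_unif_def by (subst integral_real_density) auto

lemma measure_unit_unif_greaterThan:
  assumes "0 \<le> s" "s \<le> 1"
  shows "measure unit_unif {s<..} = 1 - s"
proof -
  have "emeasure unit_unif {s<..} = (\<integral>\<^sup>+ t. indicator {s<..} t \<partial>unit_unif)"
    by simp
  also have "\<dots> = (\<integral>\<^sup>+ t. indicator {s<..<1} t \<partial>lborel)"
    using assms by (subst nn_integral_unit_unif, measurable) (intro nn_integral_cong, auto simp: indicator_def)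
  also have "\<dots> = ennreal (1 - s)"
    using assms by simp
  finally show ?thesis
    using assms by (simp add: measure_def)
qed

text \<open>
  Outside \<open>(0, 1)\<close> the quantile \<open>VaR\<close> is a junk value; cutting it off there makes it Borel on \<open>\<real>\<close>.
\<close>

definition quantile_fun :: "'a measure \<Rightarrow> ('a \<Rightarrow> real) \<Rightarrow> real \<Rightarrow> real" where
  "quantile_fun M X t = (if 0 < t \<and> t < 1 then VaR M X t else 0)"

lemma set_integral_VaR_eq:
  assumes "quantile_fun M X \<in> borel_measurable borel" "0 \<le> s"
  shows "(LBINT t:{s<..<1}. VaR M X t) = (\<integral>t. indicator {s<..} t * quantile_fun M X t \<partial>unit_unif)"
  using assms
  by (subst integral_unit_unif, measurable)
     (auto simp: set_lebesgue_integral_def quantile_fun_def indicator_def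
        intro!: Bochner_Integration.integral_cong)

section \<open>Quantile functions as generalized inverses\<close>

lemma cdf_distribution_distr:
  assumes "prob_space M" "X \<in> borel_measurable M"
  shows "cdf_distribution (distr M borel X)"
  using assms unfolding cdf_distribution_def by (simp add: prob_space.real_distribution_distr)

lemma dist_fun_eq:
  assumes "X \<in> borel_measurable M"
  shows "dist_fun M X x = measure M {\<omega> \<in> space M. X \<omega> \<le> x}"
  using assms unfolding dist_fun_def cdf_def
  by (subst measure_distr) (auto intro!: arg_cong[where f = "measure M"])

text \<open>The Galois connection between quantile and distribution function, which rests on right
  continuity of the latter. Order comparisons with \<open>VaR\<close> go through it instead of
  through the infimum.\<close>

lemma VaR_le_iff:
  assumes "prob_space M" "X \<in> borel_measurable M" "0 < p" "p < 1"
  shows "VaR M X p \<le> x \<longleftrightarrow> p \<le> dist_fun M X x"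
proof -
  interpret cdf_distribution "distr M borel X"
    using assms by (intro cdf_distribution_distr)
  show ?thesis
    using pseudoinverse[of p x] assms unfolding VaR_def dist_fun_def by simp
qed

lemma mono_dist_fun:
  assumes "prob_space M" "X \<in> borel_measurable M"
  shows "mono (dist_fun M X)"
proof -
  interpret cdf_distribution "distr M borel X"
    using assms by (intro cdf_distribution_distr)
  show ?thesis
    unfolding dist_fun_def by (rule mono)
qed

lemma measurable_dist_fun:
  assumes "prob_space M" "X \<in> borel_measurable M"
  shows "dist_fun M X \<in> borel_measurable borel"
  by (intro borel_measurable_mono mono_dist_fun assms)

lemma VaR_mono:
  assumes "prob_space M" "X \<in> borel_measurable M" "0 < s" "s \<le> t" "t < 1"
  shows "VaR M X s \<le> VaR M X t"
  using VaR_le_iff[OF assms(1,2), of s "VaR M X t"] VaR_le_iff[OF assms(1,2), of t "VaR M X t"] assms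
  by auto

lemma VaR_mono_dist_fun:
  assumes "prob_space M" "X \<in> borel_measurable M" "prob_space N" "Y \<in> borel_measurable N"
    and "0 < p" "p < 1" "\<And>x. dist_fun N Y x \<le> dist_fun M X x"
  shows "VaR M X p \<le> VaR N Y p"
  using VaR_le_iff[OF assms(1,2,5,6), of "VaR N Y p"] VaR_le_iff[OF assms(3,4,5,6), of "VaR N Y p"] assms(7)
  by (meson order.trans order.refl)

lemma measurable_quantile_fun:
  assumes "prob_space M" "X \<in> borel_measurable M"
  shows "quantile_fun M X \<in> borel_measurable borel"
proof -
  have "VaR M X \<in> borel_measurable (restrict_space borel {0<..<1})"
    using VaR_mono[OF assms] by (intro borel_measurable_mono_on_fnc) (auto simp: mono_on_def)
  then have "(\<lambda>t. indicator {0<..<1} t *\<^sub>R VaR M X t) \<in> borel_measurable borel"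
    by (subst (asm) borel_measurable_restrict_space_iff) auto
  also have "(\<lambda>t. indicator {0<..<1} t *\<^sub>R VaR M X t) = quantile_fun M X"
    by (auto simp: quantile_fun_def)
  finally show ?thesis .
qed

text \<open>By the Galois connection the event q(t) \<le> x is t \<le> F(x), which has uniform
  measure F(x).\<close>

lemma distr_quantile_fun:
  assumes "prob_space M" "X \<in> borel_measurable M"
  shows "distr unit_unif borel (quantile_fun M X) = distr M borel X"
proof -
  interpret M: cdf_distribution "distr M borel X"
    using assms by (intro cdf_distribution_distr)
  interpret U: prob_space unit_unif by (rule prob_space_unit_unif)
  have [measurable]: "quantile_fun M X \<in> borel_measurable borel"
    using assms by (rule measurable_quantile_fun)
  show ?thesis
  proof (intro cdf_unique ext)
    show "real_distribution (distr M borel X)" ..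
    show "real_distribution (distr unit_unif borel (quantile_fun M X))"
      by (rule U.real_distribution_distr) simp
    fix x
    let ?c = "cdf (distr M borel X) x"
    have c: "0 \<le> ?c" "?c \<le> 1"
      using M.cdf_nonneg M.cdf_bounded_prob by auto
    have "cdf (distr unit_unif borel (quantile_fun M X)) x = measure unit_unif {t. quantile_fun M X t \<le> x}"
      by (auto simp: cdf_def measure_distr vimage_def)
    also have "\<dots> = measure unit_unif (space unit_unif - {?c<..})"
    proof (rule U.finite_measure_eq_AE)
      show "AE t in unit_unif. t \<in> {t. quantile_fun M X t \<le> x} \<longleftrightarrow> t \<in> space unit_unif - {?c<..}"
        using AE_unit_unif_in
        by eventually_elim
          (use VaR_le_iff[OF assms] in \<open>auto simp: quantile_fun_def dist_fun_def not_less\<close>)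
    qed auto
    also have "\<dots> = 1 - (1 - ?c)"
      using c by (subst U.prob_compl) (auto simp: measure_unit_unif_greaterThan)
    finally show "cdf (distr unit_unif borel (quantile_fun M X)) x = ?c" by simp
  qed
qed

lemma integral_quantile_fun:
  fixes g :: "real \<Rightarrow> real"
  assumes "prob_space M" "X \<in> borel_measurable M" and [measurable]: "g \<in> borel_measurable borel"
  shows "(\<integral>t. g (quantile_fun M X t) \<partial>unit_unif) = (\<integral>\<omega>. g (X \<omega>) \<partial>M)"
proof -
  note [measurable] = measurable_quantile_fun[OF assms(1,2)] assms(2)
  show ?thesis
    using arg_cong[OF distr_quantile_fun[OF assms(1,2)], of "\<lambda>P. integral\<^sup>L P g"]
    by (simp add: integral_distr)
qed

lemma integrable_quantile_fun:
  assumes "prob_space M" "X \<in> borel_measurable M"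
  shows "integrable unit_unif (quantile_fun M X) \<longleftrightarrow> integrable M X"
proof -
  note [measurable] = measurable_quantile_fun[OF assms(1,2)] assms(2)
  show ?thesis
    using arg_cong[OF distr_quantile_fun[OF assms(1,2)], of "\<lambda>P. integrable P (\<lambda>x. x)"]
    by (simp add: integrable_distr_eq)
qed

section \<open>Expected shortfall as a tail integral and its variational form\<close>

lemma ES_eq_integral:
  assumes "prob_space M" "X \<in> borel_measurable M" "0 \<le> p" "p < 1"
  shows "(1 - p) * ES M X p = (\<integral>t. indicator {p<..} t * quantile_fun M X t \<partial>unit_unif)"
  using assms set_integral_VaR_eq[OF measurable_quantile_fun[OF assms(1,2)] assms(3)]
  by (simp add: ES_def)

lemma integrable_indicator_quantile_fun:
  assumes "prob_space M" "integrable M X"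
  shows "integrable unit_unif (\<lambda>t. indicator {s<..} t * quantile_fun M X t :: real)"
proof -
  have [measurable]: "X \<in> borel_measurable M" using assms by auto
  show ?thesis
    using integrable_real_mult_indicator[of "{s<..}" unit_unif "quantile_fun M X"]
      integrable_quantile_fun[OF assms(1)] assms by (simp add: mult.commute)
qed

text \<open>Half of the variational formula: integrate the pointwise bound q 1(t > p) \<le> max 0 (q
  - x) + x 1(t > p). The level \<open>x\<close> is arbitrary, and \<open>ES_eq_shortfall\<close>
  shows that the bound is attained at the quantile.\<close>

lemma ES_le_shortfall:
  assumes "prob_space M" and X: "integrable M X" and p: "0 < p" "p < 1"
  shows "(1 - p) * ES M X p \<le> (\<integral>\<omega>. max 0 (X \<omega> - x) \<partial>M) + (1 - p) * x"
proof -
  interpret U: prob_space unit_unif by (rule prob_space_unit_unif)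
  interpret prob_space M by fact
  have Xm[measurable]: "X \<in> borel_measurable M" using X by auto
  note [measurable] = measurable_quantile_fun[OF assms(1) Xm]
  have q: "integrable unit_unif (quantile_fun M X)"
    using integrable_quantile_fun[OF assms(1) Xm] X by simp
  have i: "integrable unit_unif (\<lambda>t. max 0 (quantile_fun M X t - x))"
    using q by auto
  have j: "integrable unit_unif (\<lambda>t. indicator {p<..} t * x)"
    by (intro integrable_mult_left) (auto simp: integrable_indicator_iff less_top[symmetric])
  have "(1 - p) * ES M X p \<le> (\<integral>t. max 0 (quantile_fun M X t - x) + indicator {p<..} t * x \<partial>unit_unif)"
    unfolding ES_eq_integral[OF assms(1) Xm less_imp_le[OF p(1)] p(2)]
  proof (rule integral_mono)
    show "integrable unit_unif (\<lambda>t. indicator {p<..} t * quantile_fun M X t)"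
      by (intro integrable_indicator_quantile_fun assms)
    show "integrable unit_unif (\<lambda>t. max 0 (quantile_fun M X t - x) + indicator {p<..} t * x)"
      using i j by (rule Bochner_Integration.integrable_add)
  qed (auto simp: indicator_def)
  also have "\<dots> = (\<integral>t. max 0 (quantile_fun M X t - x) \<partial>unit_unif) + (1 - p) * x"
    using i j p by (subst Bochner_Integration.integral_add) (auto simp: measure_unit_unif_greaterThan)
  also have "(\<integral>t. max 0 (quantile_fun M X t - x) \<partial>unit_unif) = (\<integral>\<omega>. max 0 (X \<omega> - x) \<partial>M)"
    by (rule integral_quantile_fun[OF assms(1) Xm]) simp
  finally show ?thesis .
qed

text \<open>Monotonicity of the quantile function q makes max 0 (q - VaR) vanish below
  \<open>p\<close> and equal q - VaR above it.\<close>

lemma ES_eq_shortfall: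
  assumes "prob_space M" and X: "integrable M X" and p: "0 < p" "p < 1"
  shows "(1 - p) * ES M X p = (\<integral>\<omega>. max 0 (X \<omega> - VaR M X p) \<partial>M) + (1 - p) * VaR M X p"
proof -
  interpret U: prob_space unit_unif by (rule prob_space_unit_unif)
  have Xm[measurable]: "X \<in> borel_measurable M" using X by auto
  note [measurable] = measurable_quantile_fun[OF assms(1) Xm]
  have q: "integrable unit_unif (quantile_fun M X)"
    using integrable_quantile_fun[OF assms(1) Xm] X by simp
  let ?v = "VaR M X p"
  have j: "integrable unit_unif (\<lambda>t. indicator {p<..} t * ?v)"
    by (intro integrable_mult_left) (auto simp: integrable_indicator_iff less_top[symmetric])
  have "(\<integral>\<omega>. max 0 (X \<omega> - ?v) \<partial>M) = (\<integral>t. max 0 (quantile_fun M X t - ?v) \<partial>unit_unif)"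
    by (rule integral_quantile_fun[OF assms(1) Xm, symmetric]) simp
  also have "\<dots> = (\<integral>t. indicator {p<..} t * quantile_fun M X t - indicator {p<..} t * ?v \<partial>unit_unif)"
  proof (rule integral_cong_AE)
    show "AE t in unit_unif. max 0 (quantile_fun M X t - ?v) =
        indicator {p<..} t * quantile_fun M X t - indicator {p<..} t * ?v"
      using AE_unit_unif_in
    proof eventually_elim
      case (elim t)
      then show ?case
        using VaR_mono[OF assms(1) Xm, of p t] VaR_mono[OF assms(1) Xm, of t p] p
        by (auto simp: quantile_fun_def indicator_def)
    qed
  qed auto
  also have "\<dots> = (1 - p) * ES M X p - (1 - p) * ?v"
    using p j by (subst Bochner_Integration.integral_diff)
      (auto intro!: integrable_indicator_quantile_fun assms simp: ES_eq_integral[OF assms(1) Xm] measure_unit_unif_greaterThan)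
  finally show ?thesis by simp
qed

text \<open>Any event that separates high values of \<open>X\<close> from low ones will do, with
  ties at the level \<open>x\<close> allowed on both sides. One inequality is
  \<open>ES_le_shortfall\<close> at \<open>x\<close>, where the positive part is (X - x) 1_B; the
  other is \<open>ES_eq_shortfall\<close> at the quantile v, where (X - v) 1_B is at most the
  positive part.\<close>

lemma ES_eq_upper_event:
  assumes "prob_space M" and X: "integrable M X" and p: "0 < p" "p < 1"
    and B: "B \<in> sets M" "measure M B = 1 - p"
    and upper: "AE \<omega> in M. \<omega> \<in> B \<longrightarrow> x \<le> X \<omega>" "AE \<omega> in M. \<omega> \<notin> B \<longrightarrow> X \<omega> \<le> x"
  shows "(1 - p) * ES M X p = (\<integral>\<omega>. X \<omega> * indicator B \<omega> \<partial>M)"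
proof (rule antisym)
  interpret prob_space M by fact
  have [measurable]: "X \<in> borel_measurable M" "B \<in> sets M" using X B by auto
  have i: "integrable M (\<lambda>\<omega>. X \<omega> * indicator B \<omega>)"
    using X B by (intro integrable_real_mult_indicator) auto
  have j: "integrable M (\<lambda>\<omega>. c * indicator B \<omega>)" for c :: real
    by (intro integrable_mult_right) (auto simp: integrable_indicator_iff less_top[symmetric])
  have eq: "(\<integral>\<omega>. X \<omega> * indicator B \<omega> \<partial>M) = (\<integral>\<omega>. (X \<omega> - c) * indicator B \<omega> \<partial>M) + (1 - p) * c" for c
    unfolding left_diff_distrib using i j B
    by (subst Bochner_Integration.integral_diff) (auto simp: right_diff_distrib left_diff_distrib mult.commute)
  have i': "integrable M (\<lambda>\<omega>. (X \<omega> - c) * indicator B \<omega>)" for c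
    unfolding left_diff_distrib using i j by (rule Bochner_Integration.integrable_diff)
  have k: "integrable M (\<lambda>\<omega>. max 0 (X \<omega> - c))" for c
    using X by auto
  have "(\<integral>\<omega>. max 0 (X \<omega> - x) \<partial>M) = (\<integral>\<omega>. (X \<omega> - x) * indicator B \<omega> \<partial>M)"
  proof (rule integral_cong_AE)
    show "AE \<omega> in M. max 0 (X \<omega> - x) = (X \<omega> - x) * indicator B \<omega>"
      using upper by eventually_elim (auto simp: indicator_def)
  qed auto
  then show "(1 - p) * ES M X p \<le> (\<integral>\<omega>. X \<omega> * indicator B \<omega> \<partial>M)"
    using ES_le_shortfall[OF assms(1) X p, of x] eq[of x] by simp
  let ?v = "VaR M X p"
  have "(\<integral>\<omega>. (X \<omega> - ?v) * indicator B \<omega> \<partial>M) \<le> (\<integral>\<omega>. max 0 (X \<omega> - ?v) \<partial>M)"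
    using i' k by (intro integral_mono) (auto simp: indicator_def)
  then show "(\<integral>\<omega>. X \<omega> * indicator B \<omega> \<partial>M) \<le> (1 - p) * ES M X p"
    using ES_eq_shortfall[OF assms(1) X p] eq[of ?v] by simp
qed

lemma ES_mono:
  assumes "prob_space M" "integrable M X" "prob_space N" "integrable N Y"
    and p: "0 < p" "p < 1" and le: "\<And>x. dist_fun N Y x \<le> dist_fun M X x"
  shows "ES M X p \<le> ES N Y p"
proof -
  have [measurable]: "X \<in> borel_measurable M" "Y \<in> borel_measurable N" using assms by auto
  have "quantile_fun M X t \<le> quantile_fun N Y t" for t
    using VaR_mono_dist_fun[of M X N Y t] assms by (auto simp: quantile_fun_def)
  then have "(1 - p) * ES M X p \<le> (1 - p) * ES N Y p"
    using p assms by (subst (1 2) ES_eq_integral)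
      (auto intro!: integral_mono integrable_indicator_quantile_fun mult_left_mono)
  then show ?thesis using p by simp
qed

lemma VaR_cong_AE:
  assumes "X \<in> borel_measurable M" "Y \<in> borel_measurable M" "AE \<omega> in M. X \<omega> = Y \<omega>"
  shows "VaR M X = VaR M Y"
proof -
  have "distr M borel X = distr M borel Y"
    using assms by (intro distr_cong_AE) auto
  then show ?thesis
    by (simp add: VaR_def dist_fun_def fun_eq_iff)
qed

lemma ES_cong_AE:
  assumes "X \<in> borel_measurable M" "Y \<in> borel_measurable M" "AE \<omega> in M. X \<omega> = Y \<omega>"
  shows "ES M X p = ES M Y p"
  unfolding ES_def VaR_cong_AE[OF assms] ..

section \<open>Probability integral transform\<close>

text \<open>Continuity yields a point \<open>x\<close> with F(x) = p. The quantile is at most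
  \<open>x\<close>, so F is at most \<open>p\<close> there, and the Galois connection gives the
  other inequality.\<close>

lemma dist_fun_VaR:
  assumes "prob_space M" "X \<in> borel_measurable M" "continuous_on UNIV (dist_fun M X)" "0 < p" "p < 1"
  shows "dist_fun M X (VaR M X p) = p"
proof -
  interpret cdf_distribution "distr M borel X"
    using assms by (intro cdf_distribution_distr)
  have F: "dist_fun M X = cdf (distr M borel X)" by (rule dist_fun_def)
  have "\<forall>\<^sub>F x in at_bot. dist_fun M X x < p"
    using order_tendstoD(2)[OF cdf_lim_at_bot \<open>0 < p\<close>] unfolding F .
  then obtain a where a: "dist_fun M X a < p"
    by (metis eventually_happens' trivial_limit_at_bot_linorder)
  have "\<forall>\<^sub>F x in at_top. p < dist_fun M X x"
    using order_tendstoD(1)[OF cdf_lim_at_top_prob \<open>p < 1\<close>] unfolding F .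
  then obtain b where b: "p < dist_fun M X b"
    by (metis eventually_happens' trivial_limit_at_top_linorder)
  have "a \<le> b"
    using a b monoD[OF mono_dist_fun[OF assms(1,2)], of b a] by linarith
  then obtain x where x: "dist_fun M X x = p"
    using IVT'[of "dist_fun M X" a p b] a b continuous_on_subset[OF assms(3)] by (metis less_imp_le top_greatest)
  then have "VaR M X p \<le> x"
    using assms by (simp add: VaR_le_iff)
  then show ?thesis
    using monoD[OF mono_dist_fun[OF assms(1,2)], of "VaR M X p" x] x
      VaR_le_iff[OF assms(1,2,4,5), of "VaR M X p"] by simp
qed

context
  fixes M :: "'a measure" and X :: "'a \<Rightarrow> real"
  assumes M: "prob_space M" and X [measurable]: "X \<in> borel_measurable M"
    and cont: "continuous_on UNIV (dist_fun M X)"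
begin

lemma measurable_dist_fun_comp: "(\<lambda>\<omega>. dist_fun M X (X \<omega>)) \<in> borel_measurable M"
  using measurable_compose[OF X measurable_dist_fun[OF M X]] .

text \<open>After \<open>X\<close> is replaced by its quantile function q on the uniform space, the
  variable becomes F(q(t)), which is t on (0, 1).\<close>

lemma distr_dist_fun: "distr M borel (\<lambda>\<omega>. dist_fun M X (X \<omega>)) = unit_unif"
proof -
  note [measurable] = measurable_quantile_fun[OF M X] measurable_dist_fun[OF M X]
  have "distr M borel (\<lambda>\<omega>. dist_fun M X (X \<omega>)) = distr (distr M borel X) borel (dist_fun M X)"
    by (simp add: distr_distr comp_def)
  also have "\<dots> = distr (distr unit_unif borel (quantile_fun M X)) borel (dist_fun M X)"
    by (simp only: distr_quantile_fun[OF M X])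
  also have "\<dots> = distr unit_unif borel (\<lambda>t. dist_fun M X (quantile_fun M X t))"
    by (simp add: distr_distr comp_def)
  also have "\<dots> = distr unit_unif borel (\<lambda>t. t)"
  proof (rule distr_cong_AE)
    show "AE t in unit_unif. dist_fun M X (quantile_fun M X t) = t"
      using AE_unit_unif_in by eventually_elim (simp add: quantile_fun_def dist_fun_VaR[OF M X cont])
  qed auto
  also have "\<dots> = unit_unif"
    by (rule distr_id2) simp
  finally show ?thesis .
qed

lemma AE_dist_fun_in: "AE \<omega> in M. 0 < dist_fun M X (X \<omega>) \<and> dist_fun M X (X \<omega>) < 1"
  using AE_unit_unif_in measurable_dist_fun_comp unfolding distr_dist_fun[symmetric]
  by (subst (asm) AE_distr_iff) auto

lemma AE_dist_fun_neq: "AE \<omega> in M. dist_fun M X (X \<omega>) \<noteq> c"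
  using AE_unit_unif_neq[of c] measurable_dist_fun_comp unfolding distr_dist_fun[symmetric]
  by (subst (asm) AE_distr_iff) auto

text \<open>The identity can fail on flat pieces of F. It holds at every point q(t) with 0 < t < 1,
  because F(q(t)) = t, and the law of \<open>X\<close> is the image of the uniform law under
  q.\<close>

lemma AE_quantile_dist_fun: "AE \<omega> in M. quantile_fun M X (dist_fun M X (X \<omega>)) = X \<omega>"
proof -
  note [measurable] = measurable_quantile_fun[OF M X] measurable_dist_fun[OF M X]
  have "AE t in unit_unif. quantile_fun M X (dist_fun M X (quantile_fun M X t)) = quantile_fun M X t"
    using AE_unit_unif_in
    by eventually_elim (auto simp: dist_fun_VaR[OF M X cont] quantile_fun_def)
  then have "AE x in distr unit_unif borel (quantile_fun M X). quantile_fun M X (dist_fun M X x) = x"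
    by (subst AE_distr_iff) auto
  then show ?thesis
    unfolding distr_quantile_fun[OF M X] by (subst (asm) AE_distr_iff) auto
qed

text \<open>If F is flat at level \<open>p\<close>, \<open>X\<close> can exceed the quantile while
  F(X) = p; since F(X) has no atoms, this happens with probability zero.\<close>

lemma AE_dist_fun_less_iff:
  assumes p: "0 < p" "p < 1"
  shows "AE \<omega> in M. p < dist_fun M X (X \<omega>) \<longleftrightarrow> VaR M X p < X \<omega>"
  using AE_dist_fun_neq[of p]
proof eventually_elim
  case (elim \<omega>)
  show ?case
    using VaR_le_iff[OF M X p, of "X \<omega>"] elim dist_fun_VaR[OF M X cont p]
      monoD[OF mono_dist_fun[OF M X], of "X \<omega>" "VaR M X p"]
    by (smt (verit, best))
qed

end

text \<open>The Galois connection turns q(U) \<le> x into U \<le> F(x). The law of q(U) is thus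
  expressed by the upper tail of \<open>U\<close>, the quantity that the order on copulas
  controls.\<close>

lemma dist_fun_quantile_comp:
  assumes "prob_space M" "X \<in> borel_measurable M" "prob_space Q"
    and [measurable]: "U \<in> borel_measurable Q"
    and "AE \<omega> in Q. 0 < U \<omega> \<and> U \<omega> < 1"
  shows "dist_fun Q (\<lambda>\<omega>. quantile_fun M X (U \<omega>)) x = 1 - measure Q {\<omega> \<in> space Q. dist_fun M X x < U \<omega>}"
proof -
  interpret Q: prob_space Q by fact
  note [measurable] = measurable_quantile_fun[OF assms(1,2)]
  have "dist_fun Q (\<lambda>\<omega>. quantile_fun M X (U \<omega>)) x = measure Q {\<omega> \<in> space Q. quantile_fun M X (U \<omega>) \<le> x}"
    by (intro dist_fun_eq) measurable
  also have "\<dots> = measure Q {\<omega> \<in> space Q. \<not> dist_fun M X x < U \<omega>}"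
  proof (rule Q.finite_measure_eq_AE)
    show "AE \<omega> in Q. (\<omega> \<in> {\<omega> \<in> space Q. quantile_fun M X (U \<omega>) \<le> x}) =
        (\<omega> \<in> {\<omega> \<in> space Q. \<not> dist_fun M X x < U \<omega>})"
      using assms(5) by eventually_elim (auto simp: quantile_fun_def VaR_le_iff[OF assms(1,2)] not_less)
  qed measurable
  also have "\<dots> = 1 - measure Q {\<omega> \<in> space Q. dist_fun M X x < U \<omega>}"
    by (rule Q.prob_neg) measurable
  finally show ?thesis .
qed

lemma ES_quantile_comp_mono:
  assumes M: "prob_space M" "X \<in> borel_measurable M" and Q: "prob_space Q" "prob_space R"
    and UV: "U \<in> borel_measurable Q" "V \<in> borel_measurable R"
    and in01: "AE \<omega> in Q. 0 < U \<omega> \<and> U \<omega> < 1" "AE \<omega> in R. 0 < V \<omega> \<and> V \<omega> < 1"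
    and int: "integrable Q (\<lambda>\<omega>. quantile_fun M X (U \<omega>))" "integrable R (\<lambda>\<omega>. quantile_fun M X (V \<omega>))"
    and le: "\<And>u. 0 \<le> u \<Longrightarrow> u \<le> 1 \<Longrightarrow>
      measure Q {\<omega> \<in> space Q. u < U \<omega>} \<le> measure R {\<omega> \<in> space R. u < V \<omega>}"
    and p: "0 < p" "p < 1"
  shows "ES Q (\<lambda>\<omega>. quantile_fun M X (U \<omega>)) p \<le> ES R (\<lambda>\<omega>. quantile_fun M X (V \<omega>)) p"
proof (rule ES_mono[OF Q(1) int(1) Q(2) int(2) p])
  interpret cdf_distribution "distr M borel X"
    using M by (intro cdf_distribution_distr)
  fix x
  have "0 \<le> dist_fun M X x" "dist_fun M X x \<le> 1"
    unfolding dist_fun_def using cdf_nonneg cdf_bounded_prob by auto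
  then show "dist_fun R (\<lambda>\<omega>. quantile_fun M X (V \<omega>)) x \<le> dist_fun Q (\<lambda>\<omega>. quantile_fun M X (U \<omega>)) x"
    using le dist_fun_quantile_comp[OF M Q(1) UV(1) in01(1)] dist_fun_quantile_comp[OF M Q(2) UV(2) in01(2)]
    by simp
qed

section \<open>Ratios of tail integrals\<close>

text \<open>
  On a partition of mesh \<open>(b - a) / N\<close> the error terms telescope to \<open>(b - a) (\<rho> a - \<rho> b) / N\<close>, which
  vanishes as \<open>N \<rightarrow> \<infinity>\<close>.  This replaces a derivative argument for quantile functions that may jump.
\<close>

lemma telescoping_mono:
  fixes \<phi> \<rho> :: "real \<Rightarrow> real"
  assumes "a \<le> b"
    and step: "\<And>s t. a \<le> s \<Longrightarrow> s \<le> t \<Longrightarrow> t \<le> b \<Longrightarrow> (t - s) * (\<rho> s - \<rho> t) \<le> \<phi> t - \<phi> s"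
  shows "\<phi> a \<le> \<phi> b"
proof -
  have le: "(b - a) / real N * (\<rho> a - \<rho> b) \<le> \<phi> b - \<phi> a" if N: "N > 0" for N :: nat
  proof -
    define x where "x i = a + real i * ((b - a) / real N)" for i
    have x: "x 0 = a" "x N = b"
      using N by (auto simp: x_def)
    have d: "x (Suc i) - x i = (b - a) / real N" for i
      by (simp add: x_def distrib_right add_divide_distrib)
    have ge: "a \<le> x i" for i
      using assms(1) by (simp add: x_def)
    have mono: "x i \<le> x (Suc i)" for i
      using d[of i] assms(1) by (smt (verit) divide_nonneg_nonneg of_nat_0_le_iff)
    have "mono x" using mono by (simp add: mono_iff_le_Suc)
    then have le: "x i \<le> b" if "i \<le> N" for i
      using that x(2) by (metis monoD)
    have "(b - a) / real N * (\<rho> a - \<rho> b) = (\<Sum>i<N. (b - a) / real N * (\<rho> (x i) - \<rho> (x (Suc i))))"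
      using sum_lessThan_telescope'[of "\<lambda>i. \<rho> (x i)" N] by (simp only: sum_distrib_left[symmetric] x)
    also have "\<dots> \<le> (\<Sum>i<N. \<phi> (x (Suc i)) - \<phi> (x i))"
      using step[OF ge mono le] by (intro sum_mono) (auto simp: d)
    also have "\<dots> = \<phi> b - \<phi> a"
      using sum_lessThan_telescope[of "\<lambda>i. \<phi> (x i)" N] by (simp add: x)
    finally show ?thesis .
  qed
  have "(\<lambda>N. (b - a) / real N * (\<rho> a - \<rho> b)) \<longlonglongrightarrow> 0"
    using tendsto_mult_left_zero[OF lim_const_over_n[of "b - a"]] by simp
  then have "0 \<le> \<phi> b - \<phi> a"
    by (rule LIMSEQ_le_const2) (use le in \<open>auto intro!: exI[of _ 1]\<close>)
  then show ?thesis by simp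
qed

text \<open>Here \<open>q1\<close> and \<open>q2\<close> play the role of minus the derivatives of
  \<open>S1\<close> and \<open>S2\<close>. The bound ln z \<le> z - 1, used once for each tail,
  bounds the increment of ln (S2 / S1) from s to t below by (t - s) (q1 s / S1 s - q1 t / S1 t):
  \<open>S1\<close> is estimated from its left end, \<open>S2\<close>, through
  \<open>hazard\<close>, from its right end. This is the error term that
  \<open>telescoping_mono\<close> tolerates.\<close>

lemma tail_ratio_mono:
  fixes q1 q2 S1 S2 :: "real \<Rightarrow> real"
  assumes "a \<le> b"
    and pos: "\<And>t. a \<le> t \<Longrightarrow> t \<le> b \<Longrightarrow> 0 < S1 t" "\<And>t. a \<le> t \<Longrightarrow> t \<le> b \<Longrightarrow> 0 < S2 t"
    and lo: "\<And>s t. a \<le> s \<Longrightarrow> s \<le> t \<Longrightarrow> t \<le> b \<Longrightarrow> (t - s) * q1 s \<le> S1 s - S1 t"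
    and up: "\<And>s t. a \<le> s \<Longrightarrow> s \<le> t \<Longrightarrow> t \<le> b \<Longrightarrow> S2 s - S2 t \<le> (t - s) * q2 t"
    and hazard: "\<And>t. a \<le> t \<Longrightarrow> t \<le> b \<Longrightarrow> q2 t * S1 t \<le> q1 t * S2 t"
  shows "S2 a * S1 b \<le> S2 b * S1 a"
proof -
  have "ln (S2 a) - ln (S1 a) \<le> ln (S2 b) - ln (S1 b)"
  proof (rule telescoping_mono[OF assms(1), where \<rho> = "\<lambda>t. q1 t / S1 t"])
    fix s t assume st: "a \<le> s" "s \<le> t" "t \<le> b"
    note p = pos(1)[of s] pos(1)[of t] pos(2)[of s] pos(2)[of t]
    have 1: "ln (S1 t) - ln (S1 s) \<le> - ((t - s) * (q1 s / S1 s))"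
    proof -
      have "ln (S1 t) - ln (S1 s) \<le> S1 t / S1 s - 1"
        using p st ln_le_minus_one[of "S1 t / S1 s"] by (simp add: ln_div)
      also have "\<dots> = - ((S1 s - S1 t) / S1 s)"
        using p st by (simp add: field_simps)
      also have "\<dots> \<le> - ((t - s) * (q1 s / S1 s))"
        using divide_right_mono[OF lo[OF st], of "S1 s"] p st by simp
      finally show ?thesis .
    qed
    have 2: "ln (S2 s) - ln (S2 t) \<le> (t - s) * (q1 t / S1 t)"
    proof -
      have "ln (S2 s) - ln (S2 t) \<le> S2 s / S2 t - 1"
        using p st ln_le_minus_one[of "S2 s / S2 t"] by (simp add: ln_div)
      also have "\<dots> = (S2 s - S2 t) / S2 t"
        using p st by (simp add: field_simps)
      also have "\<dots> \<le> (t - s) * (q2 t / S2 t)"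
        using divide_right_mono[OF up[OF st], of "S2 t"] p st by simp
      also have "\<dots> \<le> (t - s) * (q1 t / S1 t)"
        using hazard[of t] p st by (intro mult_left_mono) (auto simp: field_simps)
      finally show ?thesis .
    qed
    show "(t - s) * (q1 s / S1 s - q1 t / S1 t) \<le> ln (S2 t) - ln (S1 t) - (ln (S2 s) - ln (S1 s))"
      unfolding right_diff_distrib using 1 2 by linarith
  qed
  then have "ln (S2 a * S1 b) \<le> ln (S2 b * S1 a)"
    using pos[of a] pos[of b] assms(1) by (simp add: ln_mult)
  then show ?thesis
    using pos assms(1) by (subst (asm) ln_le_cancel_iff) auto
qed

section \<open>Increasing densities\<close>

lemma integrable_uniform_measure:
  fixes f :: "'a \<Rightarrow> real"
  assumes f: "integrable M f" and A [measurable]: "A \<in> sets M" "emeasure M A \<noteq> 0"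
  shows "integrable (uniform_measure M A) f"
proof -
  have [measurable]: "f \<in> borel_measurable M" using f by auto
  have "(\<integral>\<^sup>+ \<omega>. ennreal (norm (f \<omega>)) * indicator A \<omega> \<partial>M) \<le> (\<integral>\<^sup>+ \<omega>. ennreal (norm (f \<omega>)) \<partial>M)"
    by (intro nn_integral_mono) (auto simp: indicator_def)
  also have "\<dots> < \<infinity>"
    using f by (simp add: integrable_iff_bounded)
  finally show ?thesis
    using A by (auto simp: integrable_iff_bounded nn_integral_uniform_measure ennreal_divide_eq_top_iff
        less_top[symmetric])
qed

lemma AE_uniform_measure_of_AE:
  assumes "AE \<omega> in M. P \<omega>" "A \<in> sets M"
  shows "AE \<omega> in uniform_measure M A. P \<omega>"
  using assms by (intro AE_uniform_measureI) auto

text \<open>Layer cake: k(t) is the integral over y \<ge> 0 of the indicator of y < k(t). For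
  increasing \<open>k\<close> each nonempty superlevel set is, up to its left end, an interval (s,
  1), with s \<ge> p since \<open>k\<close> vanishes up to \<open>p\<close>. The tail comparison
  applies to each layer, and Fubini reassembles them.\<close>

lemma nn_integral_increasing_weight_mono:
  fixes q1 q2 :: "real \<Rightarrow> ennreal" and k :: "real \<Rightarrow> real"
  assumes [measurable]: "q1 \<in> borel_measurable borel" "q2 \<in> borel_measurable borel" "k \<in> borel_measurable borel"
    and k: "mono_on {0<..<1} k" "\<And>t. 0 \<le> k t" "\<And>t. t \<le> p \<Longrightarrow> k t = 0"
    and p: "0 \<le> p"
    and tails: "\<And>s. p \<le> s \<Longrightarrow> s < 1 \<Longrightarrow>
      (\<integral>\<^sup>+ t. q1 t * indicator {s<..} t \<partial>unit_unif) \<le> c * (\<integral>\<^sup>+ t. q2 t * indicator {s<..} t \<partial>unit_unif)"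
  shows "(\<integral>\<^sup>+ t. q1 t * ennreal (k t) \<partial>unit_unif) \<le> c * (\<integral>\<^sup>+ t. q2 t * ennreal (k t) \<partial>unit_unif)"
proof -
  interpret U: prob_space unit_unif by (rule prob_space_unit_unif)
  interpret P: pair_sigma_finite unit_unif lborel
    by (intro pair_sigma_finite.intro U.sigma_finite_measure_axioms lborel.sigma_finite_measure_axioms)
  let ?I = "\<lambda>y t. if 0 \<le> y \<and> y < k t then 1 else 0 :: ennreal"
  have layers: "(\<integral>\<^sup>+ t. q t * ennreal (k t) \<partial>unit_unif) = (\<integral>\<^sup>+ y. (\<integral>\<^sup>+ t. q t * ?I y t \<partial>unit_unif) \<partial>lborel)"
    if [measurable]: "q \<in> borel_measurable borel" for q
  proof -
    have "q t * ennreal (k t) = (\<integral>\<^sup>+ y. q t * ?I y t \<partial>lborel)" for t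
    proof -
      have "(\<integral>\<^sup>+ y. ?I y t \<partial>lborel) = (\<integral>\<^sup>+ y. indicator {0..<k t} y \<partial>lborel)"
        by (intro nn_integral_cong) (auto simp: indicator_def)
      also have "\<dots> = ennreal (k t)"
        using k(2)[of t] by simp
      finally show ?thesis
        by (subst nn_integral_cmult) auto
    qed
    then have "(\<integral>\<^sup>+ t. q t * ennreal (k t) \<partial>unit_unif) = (\<integral>\<^sup>+ t. (\<integral>\<^sup>+ y. q t * ?I y t \<partial>lborel) \<partial>unit_unif)"
      by simp
    also have "\<dots> = (\<integral>\<^sup>+ y. (\<integral>\<^sup>+ t. q t * ?I y t \<partial>unit_unif) \<partial>lborel)"
      by (rule P.Fubini'[symmetric]) measurable
    finally show ?thesis .
  qed
  have "(\<integral>\<^sup>+ t. q1 t * ?I y t \<partial>unit_unif) \<le> c * (\<integral>\<^sup>+ t. q2 t * ?I y t \<partial>unit_unif)" for y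
  \<comment> \<open>A layer with y < 0, or with y above all values of \<open>k\<close> on (0, 1),
    contributes zero to the left side; it is split off because the infimum of an empty set would be
    a junk value.\<close>
  proof (cases "0 \<le> y \<and> (\<exists>t\<in>{0<..<1}. y < k t)")
    case True
    define L where "L = {t\<in>{0<..<1}. y < k t}"
    define s where "s = Inf L"
    have ne: "L \<noteq> {}" and bdd: "bdd_below L"
      using True by (auto simp: L_def intro: bdd_belowI[of _ 0])
    have L: "p < t \<and> t < 1" if "t \<in> L" for t
      using that True k(3)[of t] by (force simp: L_def)
    have "p \<le> s"
      unfolding s_def using ne L by (intro cInf_greatest) (auto intro: less_imp_le)
    moreover have "s < 1"
      using ne L cInf_lower[OF _ bdd] unfolding s_def by (meson ex_in_conv le_less_trans)
    moreover have "(\<integral>\<^sup>+ t. q t * ?I y t \<partial>unit_unif) = (\<integral>\<^sup>+ t. q t * indicator {s<..} t \<partial>unit_unif)" for q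
    proof (rule nn_integral_cong_AE)
      \<comment> \<open>Whether the infimum itself lies in the superlevel set is immaterial, since a
        single point is null.\<close>
      show "AE t in unit_unif. q t * ?I y t = q t * indicator {s<..} t"
        using AE_unit_unif_in AE_unit_unif_neq[of s]
      proof eventually_elim
        case (elim t)
        have "s < t" if "y < k t"
          using that elim cInf_lower[OF _ bdd, of t] unfolding s_def by (simp add: L_def)
        moreover have "y < k t" if "s < t"
        proof -
          from that obtain r where "r \<in> L" "r < t"
            using cInf_lessD[OF ne] unfolding s_def by blast
          with k(1) elim show ?thesis
            unfolding L_def mono_on_def by (smt (verit) greaterThanLessThan_iff mem_Collect_eq)
        qed
        ultimately show ?case
          using True by (auto simp: indicator_def)
      qed
    qed
    ultimately show ?thesis
      using tails by presburger
  next
    case False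
    have "(\<integral>\<^sup>+ t. q1 t * ?I y t \<partial>unit_unif) = (\<integral>\<^sup>+ t. 0 \<partial>unit_unif)"
    proof (rule nn_integral_cong_AE)
      show "AE t in unit_unif. q1 t * ?I y t = 0"
        using AE_unit_unif_in by eventually_elim (use False in \<open>auto simp: indicator_def\<close>)
    qed
    then show ?thesis by simp
  qed
  then have "(\<integral>\<^sup>+ t. q1 t * ennreal (k t) \<partial>unit_unif) \<le>
      (\<integral>\<^sup>+ y. c * (\<integral>\<^sup>+ t. q2 t * ?I y t \<partial>unit_unif) \<partial>lborel)"
    unfolding layers[OF assms(1)] by (intro nn_integral_mono) auto
  also have "\<dots> = c * (\<integral>\<^sup>+ t. q2 t * ennreal (k t) \<partial>unit_unif)"
    unfolding layers[OF assms(2)] by (rule nn_integral_cmult) measurable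
  finally show ?thesis .
qed

text \<open>Given \<open>A\<close>, the variable \<open>U\<close> has density k / P(A) with respect
  to the uniform law. Its \<open>p\<close>-quantile s also separates the values of q(U) for every
  increasing q, so both shortfalls are integrals over (s, 1) with the same increasing weight. Since
  s \<ge> p, the tail inequalities from \<open>p\<close> on feed
  \<open>nn_integral_increasing_weight_mono\<close>.\<close>

lemma ES_increasing_density_ratio:
  fixes q1 q2 k :: "real \<Rightarrow> real"
  defines "T \<equiv> \<lambda>q s. \<integral>t. indicator {s<..} t * q t \<partial>unit_unif"
  assumes M: "prob_space M" and U [measurable]: "U \<in> borel_measurable M"
    and distr_U: "distr M borel U = unit_unif"
    and A [measurable]: "A \<in> sets M" and A_pos: "measure M A > 0"
    and k [measurable]: "k \<in> borel_measurable borel" and k_mono: "mono_on {0<..<1} k"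
    and k_nonneg: "\<And>t. 0 \<le> k t"
    and density: "\<And>g :: real \<Rightarrow> ennreal. g \<in> borel_measurable borel \<Longrightarrow>
      (\<integral>\<^sup>+ \<omega>. g (U \<omega>) * indicator A \<omega> \<partial>M) = (\<integral>\<^sup>+ t. g t * ennreal (k t) \<partial>unit_unif)"
    and q1: "integrable unit_unif q1" "mono_on {0<..<1} q1" "\<And>t. 0 \<le> q1 t"
    and q2: "integrable unit_unif q2" "mono_on {0<..<1} q2" "\<And>t. 0 \<le> q2 t"
    and p: "0 < p" "p < 1"
    and T2_pos: "0 < T q2 p"
    and tails: "\<And>s. p \<le> s \<Longrightarrow> s < 1 \<Longrightarrow> T q1 s * T q2 p \<le> T q2 s * T q1 p"
  shows "ES (uniform_measure M A) (\<lambda>\<omega>. q1 (U \<omega>)) p * T q2 p \<le> ES (uniform_measure M A) (\<lambda>\<omega>. q2 (U \<omega>)) p * T q1 p"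
proof -
  interpret M: prob_space M by fact
  define Q where "Q = uniform_measure M A"
  define m where "m = measure M A"
  have m: "emeasure M A = ennreal m" "0 < m"
    using A_pos by (auto simp: m_def M.emeasure_eq_measure)
  have Q: "prob_space Q"
    unfolding Q_def by (rule prob_space_uniform_measure) (use m in auto)
  interpret Q: prob_space Q by fact
  have sets_Q [measurable_cong, simp]: "sets Q = sets M" and space_Q [simp]: "space Q = space M"
    by (auto simp: Q_def)
  have AE_M: "AE \<omega> in M. P (U \<omega>)" if "AE t in unit_unif. P t" "{t. P t} \<in> sets borel" for P
    using that unfolding distr_U[symmetric] by (subst (asm) AE_distr_iff) auto
  have AE_Q: "AE \<omega> in Q. P (U \<omega>)" if "AE t in unit_unif. P t" "{t. P t} \<in> sets borel" for P
    unfolding Q_def using AE_M[OF that] A by (rule AE_uniform_measure_of_AE)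
  have in01: "AE \<omega> in Q. 0 < U \<omega> \<and> U \<omega> < 1"
    using AE_Q[OF AE_unit_unif_in] by auto
  interpret D: real_distribution "distr Q borel U"
    by (rule Q.real_distribution_distr) simp
  \<comment> \<open>Conditioning creates no atoms, as null sets of \<open>M\<close> stay null under
    \<open>Q\<close>. Continuity is what gives the event U > s probability exactly 1 - p.\<close>
  have "isCont (dist_fun Q U) x" for x
  proof -
    have "AE \<omega> in Q. U \<omega> \<noteq> x"
      by (rule AE_Q[OF AE_unit_unif_neq]) measurable
    then have "measure Q {\<omega> \<in> space M. U \<omega> = x} = measure Q {}"
      by (intro Q.finite_measure_eq_AE) auto
    then show ?thesis
      unfolding dist_fun_def D.isCont_cdf
      by (simp add: measure_distr vimage_def Int_def conj_commute)
  qed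
  then have cont: "continuous_on UNIV (dist_fun Q U)"
    by (simp add: continuous_at_imp_continuous_on)
  define s where "s = VaR Q U p"
  define B where "B = {\<omega> \<in> space M. s < U \<omega>}"
  have B [measurable]: "B \<in> sets M" unfolding B_def by measurable
  have below: "measure Q {\<omega> \<in> space Q. U \<omega> \<le> s} = p"
    using dist_fun_VaR[OF Q _ cont p] dist_fun_eq[of U Q s] by (simp add: s_def)
  have QB: "measure Q B = 1 - p"
    using Q.prob_neg[of "\<lambda>\<omega>. U \<omega> \<le> s"] below by (simp add: B_def not_le)
  \<comment> \<open>Both \<open>k\<close> and the functions \<open>q1\<close>, \<open>q2\<close> are
    known to be increasing on (0, 1) only, so \<open>s\<close> has to lie there.\<close>
  have "0 < s"
  proof (rule ccontr)
    assume "\<not> 0 < s"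
    then have "measure Q {\<omega> \<in> space Q. U \<omega> \<le> s} = measure Q {}"
      using in01 by (intro Q.finite_measure_eq_AE) auto
    with below p show False by simp
  qed
  have "s < 1"
  proof (rule ccontr)
    assume "\<not> s < 1"
    then have "measure Q B = measure Q {}"
      using in01 by (intro Q.finite_measure_eq_AE) (auto simp: B_def)
    with QB p show False by simp
  qed
  have weight: "ennreal (measure Q {\<omega> \<in> space M. U \<omega> \<in> S} * m) = (\<integral>\<^sup>+ t. indicator S t * ennreal (k t) \<partial>unit_unif)"
    if [measurable]: "S \<in> sets borel" for S
  proof -
    have "measure Q {\<omega> \<in> space M. U \<omega> \<in> S} * m = measure M (A \<inter> {\<omega> \<in> space M. U \<omega> \<in> S})"
      unfolding Q_def using m A_pos by (subst measure_uniform_measure) (auto simp: m_def)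
    also have "ennreal \<dots> = (\<integral>\<^sup>+ \<omega>. indicator (A \<inter> {\<omega> \<in> space M. U \<omega> \<in> S}) \<omega> \<partial>M)"
      by (simp add: M.emeasure_eq_measure)
    also have "\<dots> = (\<integral>\<^sup>+ \<omega>. indicator S (U \<omega>) * indicator A \<omega> \<partial>M)"
      by (intro nn_integral_cong) (auto simp: indicator_def)
    also have "\<dots> = (\<integral>\<^sup>+ t. indicator S t * ennreal (k t) \<partial>unit_unif)"
      by (rule density) simp
    finally show ?thesis .
  qed
  interpret U: prob_space unit_unif by (rule prob_space_unit_unif)
  \<comment> \<open>an increasing density dominates the uniform law stochastically, by comparing \<open>k\<close> with \<open>k s\<close>\<close>
  have "p \<le> s"
  proof -
    have "ennreal ((1 - s) * k s) = (\<integral>\<^sup>+ t. indicator {s<..} t * ennreal (k s) \<partial>unit_unif)"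
      using \<open>0 < s\<close> \<open>s < 1\<close> k_nonneg
      by (simp add: nn_integral_multc U.emeasure_eq_measure measure_unit_unif_greaterThan ennreal_mult)
    also have "\<dots> \<le> (\<integral>\<^sup>+ t. indicator {s<..} t * ennreal (k t) \<partial>unit_unif)"
    proof (rule nn_integral_mono_AE)
      show "AE t in unit_unif. indicator {s<..} t * ennreal (k s) \<le> indicator {s<..} t * ennreal (k t)"
        using AE_unit_unif_in
        by eventually_elim (use \<open>0 < s\<close> \<open>s < 1\<close> in
          \<open>auto simp: indicator_def intro!: ennreal_leI mono_onD[OF k_mono]\<close>)
    qed
    also have "\<dots> = ennreal ((1 - p) * m)"
      using weight[of "{s<..}"] QB by (simp add: B_def)
    finally have 1: "(1 - s) * k s \<le> (1 - p) * m"
      using p m by (subst (asm) ennreal_le_iff) auto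
    have "ennreal (p * m) = (\<integral>\<^sup>+ t. indicator {..s} t * ennreal (k t) \<partial>unit_unif)"
      using weight[of "{..s}"] below by simp
    also have "\<dots> \<le> (\<integral>\<^sup>+ t. indicator {..s} t * ennreal (k s) \<partial>unit_unif)"
    proof (rule nn_integral_mono_AE)
      show "AE t in unit_unif. indicator {..s} t * ennreal (k t) \<le> indicator {..s} t * ennreal (k s)"
        using AE_unit_unif_in
        by eventually_elim (use \<open>0 < s\<close> \<open>s < 1\<close> in
          \<open>auto simp: indicator_def intro!: ennreal_leI mono_onD[OF k_mono]\<close>)
    qed
    also have "\<dots> = ennreal (s * k s)"
    proof -
      have "measure unit_unif (space unit_unif - {s<..}) = s"
        using \<open>0 < s\<close> \<open>s < 1\<close> by (subst U.prob_compl) (auto simp: measure_unit_unif_greaterThan)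
      moreover have "space unit_unif - {s<..} = {..s}" by auto
      ultimately show ?thesis
        using \<open>0 < s\<close> k_nonneg by (simp add: nn_integral_multc U.emeasure_eq_measure ennreal_mult)
    qed
    finally have 2: "p * m \<le> s * k s"
      using \<open>0 < s\<close> k_nonneg by (subst (asm) ennreal_le_iff) auto
    \<comment> \<open>Eliminating \<open>k s\<close> between the two bounds leaves p m (1 - s) \<le>
      s (1 - p) m, where the terms p m s cancel.\<close>
    have "p * m * (1 - s) \<le> s * k s * (1 - s)"
      using 2 \<open>s < 1\<close> by (intro mult_right_mono) auto
    also have "\<dots> = s * ((1 - s) * k s)" by simp
    also have "\<dots> \<le> s * ((1 - p) * m)"
      using 1 \<open>0 < s\<close> by (intro mult_left_mono) auto
    finally have "m * p \<le> m * s" by (simp add: algebra_simps)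
    then show ?thesis using m by simp
  qed
  \<comment> \<open>The cut-off weight is still increasing because \<open>k\<close> is nonnegative,
    and it vanishes up to \<open>p\<close> because p \<le> s.\<close>
  define K where "K t = indicator {s<..} t * k t" for t
  have ES_Q: "ennreal ((1 - p) * ES Q (\<lambda>\<omega>. q (U \<omega>)) p * m) = (\<integral>\<^sup>+ t. ennreal (q t) * ennreal (K t) \<partial>unit_unif)"
    "0 \<le> ES Q (\<lambda>\<omega>. q (U \<omega>)) p"
    if q: "integrable unit_unif q" "mono_on {0<..<1} q" "\<And>t. 0 \<le> q t" for q
  proof -
    have [measurable]: "q \<in> borel_measurable borel" using q(1) by auto
    have "integrable M (\<lambda>\<omega>. q (U \<omega>))"
      using q(1) unfolding distr_U[symmetric] by (simp add: integrable_distr_eq)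
    then have int: "integrable Q (\<lambda>\<omega>. q (U \<omega>))"
      unfolding Q_def using m by (intro integrable_uniform_measure) auto
    \<comment> \<open>The event U > s separates the values of q(U) at the level q(s), even where q
      jumps or is flat.\<close>
    have ES: "(1 - p) * ES Q (\<lambda>\<omega>. q (U \<omega>)) p = (\<integral>\<omega>. q (U \<omega>) * indicator B \<omega> \<partial>Q)"
    proof (rule ES_eq_upper_event[OF Q int p _ QB, where x = "q s"])
      show "AE \<omega> in Q. \<omega> \<in> B \<longrightarrow> q s \<le> q (U \<omega>)" "AE \<omega> in Q. \<omega> \<notin> B \<longrightarrow> q (U \<omega>) \<le> q s"
        using in01 AE_space
        by (eventually_elim, use \<open>0 < s\<close> \<open>s < 1\<close> in
          \<open>auto simp: B_def intro!: mono_onD[OF q(2)]\<close>)+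
    qed simp
    then have "0 \<le> (1 - p) * ES Q (\<lambda>\<omega>. q (U \<omega>)) p"
      using q(3) by (auto intro!: integral_nonneg_AE)
    then show "0 \<le> ES Q (\<lambda>\<omega>. q (U \<omega>)) p"
      using p by (simp add: zero_le_mult_iff)
    have "ennreal ((1 - p) * ES Q (\<lambda>\<omega>. q (U \<omega>)) p) = (\<integral>\<^sup>+ \<omega>. ennreal (q (U \<omega>) * indicator B \<omega>) \<partial>Q)"
      unfolding ES using int q(3)
      by (intro nn_integral_eq_integral[symmetric] integrable_real_mult_indicator) auto
    also have "\<dots> = (\<integral>\<^sup>+ \<omega>. ennreal (q (U \<omega>) * indicator B \<omega>) * indicator A \<omega> \<partial>M) / ennreal m"
      unfolding Q_def by (subst nn_integral_uniform_measure) (auto simp: m)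
    finally have "ennreal ((1 - p) * ES Q (\<lambda>\<omega>. q (U \<omega>)) p) * ennreal m =
        (\<integral>\<^sup>+ \<omega>. ennreal (q (U \<omega>) * indicator B \<omega>) * indicator A \<omega> \<partial>M)"
      using m by (simp add: ennreal_divide_times ennreal_times_divide[symmetric] divide_ennreal mult_divide_eq_ennreal)
    also have "\<dots> = (\<integral>\<^sup>+ \<omega>. ennreal (q (U \<omega>) * indicator {s<..} (U \<omega>)) * indicator A \<omega> \<partial>M)"
      by (intro nn_integral_cong) (auto simp: B_def indicator_def)
    also have "\<dots> = (\<integral>\<^sup>+ t. ennreal (q t * indicator {s<..} t) * ennreal (k t) \<partial>unit_unif)"
      by (rule density) simp
    also have "\<dots> = (\<integral>\<^sup>+ t. ennreal (q t) * ennreal (K t) \<partial>unit_unif)"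
      by (intro nn_integral_cong) (auto simp: K_def indicator_def)
    finally show "ennreal ((1 - p) * ES Q (\<lambda>\<omega>. q (U \<omega>)) p * m) = (\<integral>\<^sup>+ t. ennreal (q t) * ennreal (K t) \<partial>unit_unif)"
      using m p \<open>0 \<le> ES Q (\<lambda>\<omega>. q (U \<omega>)) p\<close> by (simp add: ennreal_mult)
  qed
  have T: "(\<integral>\<^sup>+ t. ennreal (q t) * indicator {r<..} t \<partial>unit_unif) = ennreal (T q r)" "0 \<le> T q r"
    if q: "integrable unit_unif q" "\<And>t. 0 \<le> q t" for q r
  proof -
    have "(\<integral>\<^sup>+ t. ennreal (q t) * indicator {r<..} t \<partial>unit_unif) = (\<integral>\<^sup>+ t. ennreal (indicator {r<..} t * q t) \<partial>unit_unif)"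
      by (intro nn_integral_cong) (auto simp: indicator_def)
    also have "\<dots> = ennreal (T q r)"
      unfolding T_def using q integrable_real_mult_indicator[of "{r<..}" unit_unif q]
      by (intro nn_integral_eq_integral) (auto simp: mult.commute)
    finally show "(\<integral>\<^sup>+ t. ennreal (q t) * indicator {r<..} t \<partial>unit_unif) = ennreal (T q r)" .
    show "0 \<le> T q r"
      unfolding T_def using q by (intro integral_nonneg_AE) auto
  qed
  \<comment> \<open>With this constant the tail comparison is an equality at
    \<open>p\<close>.\<close>
  let ?c = "T q1 p / T q2 p"
  have c: "0 \<le> ?c"
    using T(2)[OF q1(1,3)] T2_pos by simp
  have "(\<integral>\<^sup>+ t. ennreal (q1 t) * ennreal (K t) \<partial>unit_unif) \<le>
      ennreal ?c * (\<integral>\<^sup>+ t. ennreal (q2 t) * ennreal (K t) \<partial>unit_unif)"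
  proof (rule nn_integral_increasing_weight_mono[where p = p])
    show "mono_on {0<..<1} K"
      using k_mono k_nonneg by (auto simp: K_def mono_on_def indicator_def)
    show "K t = 0" if "t \<le> p" for t
      using that \<open>p \<le> s\<close> by (simp add: K_def)
    show "0 \<le> K t" for t
      using k_nonneg by (simp add: K_def)
    show "(\<integral>\<^sup>+ t. ennreal (q1 t) * indicator {r<..} t \<partial>unit_unif) \<le>
        ennreal ?c * (\<integral>\<^sup>+ t. ennreal (q2 t) * indicator {r<..} t \<partial>unit_unif)" if "p \<le> r" "r < 1" for r
    proof -
      have "T q1 r \<le> ?c * T q2 r"
        using tails[OF that] T2_pos by (simp add: field_simps)
      then show ?thesis
        unfolding T(1)[OF q1(1,3)] T(1)[OF q2(1,3)] ennreal_mult[OF c T(2)[OF q2(1,3)], symmetric]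
        by (rule ennreal_leI)
    qed
  qed (use p q1(1) q2(1) in \<open>auto simp: K_def\<close>)
  then have "ennreal ((1 - p) * ES Q (\<lambda>\<omega>. q1 (U \<omega>)) p * m) \<le>
      ennreal (?c * ((1 - p) * ES Q (\<lambda>\<omega>. q2 (U \<omega>)) p * m))"
    unfolding ES_Q(1)[OF q1, symmetric] ES_Q(1)[OF q2, symmetric]
    using c p m ES_Q(2)[OF q2] by (subst ennreal_mult) auto
  then have "(1 - p) * ES Q (\<lambda>\<omega>. q1 (U \<omega>)) p * m \<le> ?c * ((1 - p) * ES Q (\<lambda>\<omega>. q2 (U \<omega>)) p * m)"
    by (rule ennreal_le_iff[THEN iffD1, rotated])
      (use c p m ES_Q(2)[OF q2] in \<open>intro mult_nonneg_nonneg, auto\<close>)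
  then have "((1 - p) * m) * ES Q (\<lambda>\<omega>. q1 (U \<omega>)) p \<le> ((1 - p) * m) * (?c * ES Q (\<lambda>\<omega>. q2 (U \<omega>)) p)"
    by (simp add: mult_ac)
  then have "ES Q (\<lambda>\<omega>. q1 (U \<omega>)) p \<le> ?c * ES Q (\<lambda>\<omega>. q2 (U \<omega>)) p"
    using p m by (subst (asm) mult_le_cancel_left_pos) auto
  then show ?thesis
    using T2_pos unfolding Q_def by (simp add: field_simps)
qed

section \<open>Stochastic increasingness and copula tails\<close>

lemma measurable_stress_event:
  assumes "\<And>i. i \<in> {1..n} \<Longrightarrow> X i \<in> borel_measurable M"
  shows "stress_event n M X p \<in> sets M"
  using assms unfolding stress_event_def by measurable

text \<open>The indicator of the open upper orthant that defines the stress event is bounded and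
  componentwise increasing, so the conditional probability of that event given \<open>X 1\<close> is
  an increasing function \<open>h\<close> of \<open>X 1\<close>. Equivalently, \<open>h\<close> is
  the unnormalised density of the stressed law of \<open>X 1\<close> relative to its original
  law.\<close>

lemma SI_density:
  assumes M: "prob_space M" and X: "\<And>i. i \<in> {1..n} \<Longrightarrow> X i \<in> borel_measurable M" and n: "n \<ge> 1"
    and SI: "SI_in_first n M X"
  obtains h :: "real \<Rightarrow> real" where "mono h" "\<And>x. 0 \<le> h x"
    and "\<And>g :: real \<Rightarrow> ennreal. g \<in> borel_measurable borel \<Longrightarrow>
      (\<integral>\<^sup>+ \<omega>. g (X 1 \<omega>) * indicator (stress_event n M X p) \<omega> \<partial>M) =
      (\<integral>\<^sup>+ \<omega>. g (X 1 \<omega>) * ennreal (h (X 1 \<omega>)) \<partial>M)"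
proof -
  note One_nat_def [simp del]
  interpret M: prob_space M by fact
  let ?A = "stress_event n M X p"
  have A [measurable]: "?A \<in> sets M"
    using X by (rule measurable_stress_event)
  have X1 [measurable]: "X 1 \<in> borel_measurable M" using X n by auto
  define \<phi> :: "(nat \<Rightarrow> real) \<Rightarrow> real" where
    "\<phi> x = (if \<forall>j\<in>{2..n}. VaR M (X j) (p j) < x j then 1 else 0)" for x
  have \<phi> [measurable]: "\<phi> \<in> borel_measurable (PiM {2..n} (\<lambda>_. borel))"
    unfolding \<phi>_def by measurable
  have \<phi>_rvec: "\<phi> (rvec {2..n} X \<omega>) = indicator ?A \<omega>" if "\<omega> \<in> space M" for \<omega>
    using that by (auto simp: \<phi>_def rvec_def stress_event_def indicator_def)
  define F where "F = vimage_algebra (space M) (X 1) borel"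
  have "subalgebra M F"
    using measurable_sets[OF X1] by (auto simp: subalgebra_def F_def sets_vimage_algebra2)
  then interpret F: finite_measure_subalgebra M F
    by unfold_locales
  have X1F [measurable]: "X 1 \<in> borel_measurable F"
    unfolding F_def by (rule measurable_vimage_algebra1) auto
  have "bounded (\<phi> ` ({2..n} \<rightarrow>\<^sub>E UNIV))"
    by (rule boundedI[where B = 1]) (auto simp: \<phi>_def)
  moreover have "\<forall>x \<in> {2..n} \<rightarrow>\<^sub>E UNIV. \<forall>y \<in> {2..n} \<rightarrow>\<^sub>E UNIV.
      (\<forall>i\<in>{2..n}. x i \<le> y i) \<longrightarrow> \<phi> x \<le> \<phi> y"
    by (auto simp: \<phi>_def intro: less_le_trans)
  ultimately obtain h where h: "mono h"
    "AE \<omega> in M. real_cond_exp M F (\<lambda>\<omega>. \<phi> (rvec {2..n} X \<omega>)) \<omega> = h (X 1 \<omega>)"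
    using SI[unfolded SI_in_first_def F_def[symmetric], rule_format, OF \<phi>] by blast
  have rv [measurable]: "(\<lambda>\<omega>. \<phi> (rvec {2..n} X \<omega>)) \<in> borel_measurable M"
    using \<phi>_rvec by (subst measurable_cong[where g = "indicator ?A"]) auto
  \<comment> \<open>The version \<open>h\<close> may be negative where the law of \<open>X 1\<close>
    puts no mass; truncation at 0 keeps it increasing and changes \<open>h (X 1 \<omega>)\<close>
    only on a null set.\<close>
  define h' where "h' x = max 0 (h x)" for x
  have "mono h'"
    unfolding h'_def by (intro monoI max.mono order.refl monoD[OF h(1)])
  then have [measurable]: "h' \<in> borel_measurable borel"
    by (rule borel_measurable_mono)
  have "AE \<omega> in M. real_cond_exp M F (\<lambda>\<omega>. \<phi> (rvec {2..n} X \<omega>)) \<omega> \<ge> 0"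
    by (rule F.real_cond_exp_pos[OF _ rv]) (simp add: \<phi>_def)
  then have h': "AE \<omega> in M. real_cond_exp M F (\<lambda>\<omega>. \<phi> (rvec {2..n} X \<omega>)) \<omega> = h' (X 1 \<omega>)"
    using h(2) by eventually_elim (simp add: h'_def)
  \<comment> \<open>Equality of the two image laws is checked on Borel sets and then yields the
    identity for every nonnegative Borel g at once.\<close>
  define D1 where "D1 = distr (density M (indicator ?A)) borel (X 1)"
  define D2 where "D2 = distr (density M (\<lambda>\<omega>. ennreal (h' (X 1 \<omega>)))) borel (X 1)"
  have "D1 = D2"
  proof (rule measure_eqI)
    show "sets D1 = sets D2" by (simp add: D1_def D2_def)
    fix S assume "S \<in> sets D1"
    then have S [measurable]: "S \<in> sets borel" by (simp add: D1_def)
    let ?f = "\<lambda>\<omega>. indicator S (X 1 \<omega>) :: real"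
    have i: "integrable M (\<lambda>\<omega>. ?f \<omega> * \<phi> (rvec {2..n} X \<omega>))"
    proof (rule M.integrable_const_bound[where B = 1])
      show "AE \<omega> in M. norm (?f \<omega> * \<phi> (rvec {2..n} X \<omega>)) \<le> 1"
        by (simp add: \<phi>_def indicator_def)
    qed measurable
    have f: "?f \<in> borel_measurable F" by measurable
    \<comment> \<open>The averaging property of conditional expectation, with the indicator of X1 in
      S as multiplier.\<close>
    note j = F.real_cond_exp_intg[OF i f rv]
    have "emeasure D1 S = (\<integral>\<^sup>+ \<omega>. indicator ?A \<omega> * indicator (X 1 -` S \<inter> space M) \<omega> \<partial>M)"
      unfolding D1_def by (subst emeasure_distr) (auto simp: emeasure_density)
    also have "\<dots> = (\<integral>\<^sup>+ \<omega>. ennreal (?f \<omega> * \<phi> (rvec {2..n} X \<omega>)) \<partial>M)"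
      by (intro nn_integral_cong) (auto simp: \<phi>_rvec indicator_def)
    also have "\<dots> = ennreal (\<integral>\<omega>. ?f \<omega> * \<phi> (rvec {2..n} X \<omega>) \<partial>M)"
      using i by (intro nn_integral_eq_integral) (auto simp: \<phi>_def)
    also have "\<dots> = ennreal (\<integral>\<omega>. ?f \<omega> * real_cond_exp M F (\<lambda>\<omega>. \<phi> (rvec {2..n} X \<omega>)) \<omega> \<partial>M)"
      by (simp only: j)
    also have "\<dots> = (\<integral>\<^sup>+ \<omega>. ennreal (?f \<omega> * real_cond_exp M F (\<lambda>\<omega>. \<phi> (rvec {2..n} X \<omega>)) \<omega>) \<partial>M)"
    proof (rule nn_integral_eq_integral[symmetric, OF j(1)])
      show "AE \<omega> in M. 0 \<le> ?f \<omega> * real_cond_exp M F (\<lambda>\<omega>. \<phi> (rvec {2..n} X \<omega>)) \<omega>"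
        using h' by eventually_elim (simp add: h'_def)
    qed
    also have "\<dots> = (\<integral>\<^sup>+ \<omega>. ennreal (h' (X 1 \<omega>)) * indicator (X 1 -` S \<inter> space M) \<omega> \<partial>M)"
    proof (rule nn_integral_cong_AE)
      show "AE \<omega> in M. ennreal (?f \<omega> * real_cond_exp M F (\<lambda>\<omega>. \<phi> (rvec {2..n} X \<omega>)) \<omega>) =
          ennreal (h' (X 1 \<omega>)) * indicator (X 1 -` S \<inter> space M) \<omega>"
        using h' AE_space by eventually_elim (auto simp: indicator_def)
    qed
    also have "\<dots> = emeasure D2 S"
      unfolding D2_def by (subst emeasure_distr) (auto simp: emeasure_density)
    finally show "emeasure D1 S = emeasure D2 S" .
  qed
  show thesis
  proof
    show "mono h'" by fact
    show "0 \<le> h' x" for x by (simp add: h'_def)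
    fix g :: "real \<Rightarrow> ennreal" assume [measurable]: "g \<in> borel_measurable borel"
    have "(\<integral>\<^sup>+ \<omega>. g (X 1 \<omega>) * indicator ?A \<omega> \<partial>M) = (\<integral>\<^sup>+ x. g x \<partial>D1)"
      unfolding D1_def by (simp add: nn_integral_distr nn_integral_density mult.commute)
    also have "\<dots> = (\<integral>\<^sup>+ \<omega>. g (X 1 \<omega>) * ennreal (h' (X 1 \<omega>)) \<partial>M)"
      unfolding \<open>D1 = D2\<close> D2_def by (simp add: nn_integral_distr nn_integral_density mult.commute)
    finally show "(\<integral>\<^sup>+ \<omega>. g (X 1 \<omega>) * indicator ?A \<omega> \<partial>M) = (\<integral>\<^sup>+ \<omega>. g (X 1 \<omega>) * ennreal (h' (X 1 \<omega>)) \<partial>M)" .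
  qed
qed

text \<open>Up to null sets, F_j(X_j) > p_j is the stress condition on X_j. The first level is left
  free, so the copula tail along the first coordinate is the unnormalised tail of F_1(X_1) on the
  stress event.\<close>

lemma joint_tail_copula:
  assumes M: "prob_space M" and n: "n \<ge> 1"
    and X: "\<And>i. i \<in> {1..n} \<Longrightarrow> X i \<in> borel_measurable M"
    and cont: "\<And>i. i \<in> {1..n} \<Longrightarrow> continuous_on UNIV (dist_fun M (X i))"
    and p: "\<And>i. i \<in> {1..n} \<Longrightarrow> 0 < p i \<and> p i < 1"
  shows "joint_tail n (copula n M X) (p(1 := u)) =
    measure M {\<omega> \<in> stress_event n M X p. u < dist_fun M (X 1) (X 1 \<omega>)}"
proof -
  interpret M: prob_space M by fact
  have FX [measurable]: "(\<lambda>\<omega>. dist_fun M (X i) (X i \<omega>)) \<in> borel_measurable M" if "i \<in> {1..n}" for i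
    using measurable_dist_fun_comp[OF M X[OF that] cont[OF that]] .
  have rv [measurable]: "rvec {1..n} (\<lambda>i \<omega>. dist_fun M (X i) (X i \<omega>)) \<in> measurable M (PiM {1..n} (\<lambda>_. borel))"
    unfolding rvec_def by (intro measurable_restrict FX)
  have "{v \<in> space (PiM {1..n} (\<lambda>_. borel :: real measure)). \<forall>i\<in>{1..n}. (p(1 := u)) i < v i}
      \<in> sets (PiM {1..n} (\<lambda>_. borel))"
    by measurable
  then have "joint_tail n (copula n M X) (p(1 := u)) =
      measure M {\<omega> \<in> space M. \<forall>i\<in>{1..n}. (p(1 := u)) i < dist_fun M (X i) (X i \<omega>)}"
    unfolding joint_tail_def copula_def
    by (subst measure_distr[OF rv])
       (use measurable_space[OF rv] in \<open>auto simp: rvec_def intro!: arg_cong[where f = "measure M"]\<close>)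
  also have "\<dots> = measure M {\<omega> \<in> stress_event n M X p. u < dist_fun M (X 1) (X 1 \<omega>)}"
  proof (rule M.finite_measure_eq_AE)
    have "AE \<omega> in M. \<forall>i\<in>{2..n}. p i < dist_fun M (X i) (X i \<omega>) \<longleftrightarrow> VaR M (X i) (p i) < X i \<omega>"
      using AE_dist_fun_less_iff[OF M X cont] p by (intro AE_finite_allI) auto
    then show "AE \<omega> in M. (\<omega> \<in> {\<omega> \<in> space M. \<forall>i\<in>{1..n}. (p(1 := u)) i < dist_fun M (X i) (X i \<omega>)}) =
        (\<omega> \<in> {\<omega> \<in> stress_event n M X p. u < dist_fun M (X 1) (X 1 \<omega>)})"
    proof eventually_elim
      case (elim \<omega>)
      have "{1..n} = insert 1 {2..n}" using n by auto
      with elim show ?case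
        by (auto simp: stress_event_def)
    qed
    show "{\<omega> \<in> space M. \<forall>i\<in>{1..n}. (p(1 := u)) i < dist_fun M (X i) (X i \<omega>)} \<in> sets M"
      by (intro sets.sets_Collect_finite_All) auto
    have "{\<omega> \<in> stress_event n M X p. u < dist_fun M (X 1) (X 1 \<omega>)} =
        {\<omega> \<in> space M. \<forall>i\<in>{2..n}. VaR M (X i) (p i) < X i \<omega>} \<inter> {\<omega> \<in> space M. u < dist_fun M (X 1) (X 1 \<omega>)}"
      by (auto simp: stress_event_def)
    also have "\<dots> \<in> sets M"
    proof (intro sets.Int sets.sets_Collect_finite_All)
      show "{\<omega> \<in> space M. VaR M (X i) (p i) < X i \<omega>} \<in> sets M" if "i \<in> {2..n}" for i
        using X[of i] that by auto
      show "{\<omega> \<in> space M. u < dist_fun M (X 1) (X 1 \<omega>)} \<in> sets M"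
        using FX[of 1] n by auto
    qed auto
    finally show "{\<omega> \<in> stress_event n M X p. u < dist_fun M (X 1) (X 1 \<omega>)} \<in> sets M" .
  qed
  finally show ?thesis .
qed

section \<open>Expected proportional shortfall\<close>

text \<open>On the event X = 0 the variable F(X) takes the single value F(0), which has probability
  zero because F is continuous.\<close>

lemma dist_fun_0_eq_0:
  assumes "prob_space M" "X \<in> borel_measurable M" "continuous_on UNIV (dist_fun M X)" "AE \<omega> in M. 0 \<le> X \<omega>"
  shows "dist_fun M X 0 = 0"
proof -
  interpret prob_space M by fact
  note [measurable] = assms(2)
  have "measure M {\<omega> \<in> space M. X \<omega> \<le> 0} = measure M {}"
  proof (rule finite_measure_eq_AE)
    show "AE \<omega> in M. (\<omega> \<in> {\<omega> \<in> space M. X \<omega> \<le> 0}) = (\<omega> \<in> {})"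
      using assms(4) AE_dist_fun_neq[OF assms(1-3), of "dist_fun M X 0"]
      by eventually_elim (metis empty_iff mem_Collect_eq order_antisym)
  qed auto
  then show ?thesis using dist_fun_eq[OF assms(2)] by simp
qed

text \<open>Hence the level sets D_X and D_Y in \<open>ps_le\<close> are all of (0, 1), and its
  inequality is available at every level.\<close>

lemma VaR_pos:
  assumes "prob_space M" "X \<in> borel_measurable M" "continuous_on UNIV (dist_fun M X)" "AE \<omega> in M. 0 \<le> X \<omega>"
    and "0 < p" "p < 1"
  shows "0 < VaR M X p"
  using VaR_le_iff[OF assms(1,2,5,6), of 0] dist_fun_0_eq_0[OF assms(1-4)] assms(5) by linarith

lemma ES_pos:
  assumes "prob_space M" "integrable M X" "continuous_on UNIV (dist_fun M X)" "AE \<omega> in M. 0 \<le> X \<omega>"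
    and p: "0 < p" "p < 1"
  shows "0 < ES M X p"
proof -
  have [measurable]: "X \<in> borel_measurable M" using assms by auto
  have "0 < (1 - p) * VaR M X p"
    using VaR_pos assms by (intro mult_pos_pos) auto
  also have "\<dots> \<le> (1 - p) * ES M X p"
    unfolding ES_eq_shortfall[OF assms(1,2) p] by (simp add: integral_nonneg_AE)
  finally show ?thesis
    using p by (simp add: zero_less_mult_iff)
qed

text \<open>EPS plus 1 - p is thus the tail integral divided by the quantile, the reciprocal of the
  ratio compared in the assumption \<open>hazard\<close> of \<open>tail_ratio_mono\<close>.\<close>

lemma EPS_eq:
  assumes "prob_space M" "integrable M X" "0 < p" "p < 1" "0 < VaR M X p"
  shows "EPS M X p = (1 - p) * ES M X p / VaR M X p - (1 - p)"
proof -
  have "EPS M X p = (\<integral>\<omega>. max 0 (X \<omega> - VaR M X p) / VaR M X p \<partial>M)"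
    unfolding EPS_def using assms(5)
    by (intro Bochner_Integration.integral_cong) (auto simp: max_def divide_simps)
  also have "\<dots> = (\<integral>\<omega>. max 0 (X \<omega> - VaR M X p) \<partial>M) / VaR M X p"
    by simp
  finally show ?thesis
    using ES_eq_shortfall[OF assms(1-4)] assms(5) by (simp add: field_simps)
qed

text \<open>The difference is the integral of the quantile function from s to t, where it lies
  between its end values; the two bounds supply the assumptions \<open>lo\<close> and
  \<open>up\<close> of \<open>tail_ratio_mono\<close>.\<close>

lemma tail_integral_diff_bounds:
  assumes "prob_space M" "integrable M X" and st: "0 < s" "s \<le> t" "t < 1"
  shows "(t - s) * VaR M X s \<le> (1 - s) * ES M X s - (1 - t) * ES M X t"
    and "(1 - s) * ES M X s - (1 - t) * ES M X t \<le> (t - s) * VaR M X t"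
proof -
  have X [measurable]: "X \<in> borel_measurable M" using assms by auto
  interpret U: prob_space unit_unif by (rule prob_space_unit_unif)
  note [measurable] = measurable_quantile_fun[OF assms(1) X]
  let ?d = "\<lambda>r. indicator {s<..} r - indicator {t<..} r :: real"
  have ind: "integrable unit_unif (indicator {r<..} :: real \<Rightarrow> real)" for r
    by (auto simp: integrable_indicator_iff less_top[symmetric])
  have d: "integrable unit_unif (\<lambda>r. ?d r * c)" for c
    using ind by auto
  have dc: "(\<integral>r. ?d r * c \<partial>unit_unif) = (t - s) * c" for c
    using ind st by (simp add: measure_unit_unif_greaterThan)
  have dq: "integrable unit_unif (\<lambda>r. ?d r * quantile_fun M X r)"
    unfolding left_diff_distrib
    by (intro Bochner_Integration.integrable_diff integrable_indicator_quantile_fun assms)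
  have eq: "(1 - s) * ES M X s - (1 - t) * ES M X t = (\<integral>r. ?d r * quantile_fun M X r \<partial>unit_unif)"
    unfolding left_diff_distrib using st
    by (subst Bochner_Integration.integral_diff)
       (auto intro!: integrable_indicator_quantile_fun assms simp: ES_eq_integral[OF assms(1) X, symmetric] left_diff_distrib)
  have "(\<integral>r. ?d r * VaR M X s \<partial>unit_unif) \<le> (\<integral>r. ?d r * quantile_fun M X r \<partial>unit_unif)"
  proof (rule integral_mono_AE[OF d dq])
    show "AE r in unit_unif. ?d r * VaR M X s \<le> ?d r * quantile_fun M X r"
      using AE_unit_unif_in
      by eventually_elim (use st VaR_mono[OF assms(1) X] in \<open>auto simp: indicator_def quantile_fun_def\<close>)
  qed
  then show "(t - s) * VaR M X s \<le> (1 - s) * ES M X s - (1 - t) * ES M X t"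
    unfolding dc eq .
  have "(\<integral>r. ?d r * quantile_fun M X r \<partial>unit_unif) \<le> (\<integral>r. ?d r * VaR M X t \<partial>unit_unif)"
  proof (rule integral_mono_AE[OF dq d])
    show "AE r in unit_unif. ?d r * quantile_fun M X r \<le> ?d r * VaR M X t"
      using AE_unit_unif_in
      by eventually_elim (use st VaR_mono[OF assms(1) X] in \<open>auto simp: indicator_def quantile_fun_def\<close>)
  qed
  then show "(1 - s) * ES M X s - (1 - t) * ES M X t \<le> (t - s) * VaR M X t"
    unfolding dc eq .
qed

lemma ps_le_tail_ratio_mono:
  assumes M: "prob_space M" "integrable M X" "continuous_on UNIV (dist_fun M X)" "AE \<omega> in M. 0 \<le> X \<omega>"
    and N: "prob_space N" "integrable N Y" "continuous_on UNIV (dist_fun N Y)" "AE \<omega> in N. 0 \<le> Y \<omega>"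
    and ps: "ps_le M X N Y" and ab: "0 < a" "a \<le> b" "b < 1"
  shows "((1 - a) * ES N Y a) * ((1 - b) * ES M X b) \<le> ((1 - b) * ES N Y b) * ((1 - a) * ES M X a)"
proof (rule tail_ratio_mono[where ?q1.0 = "VaR M X" and ?q2.0 = "VaR N Y"
      and ?S1.0 = "\<lambda>t. (1 - t) * ES M X t" and ?S2.0 = "\<lambda>t. (1 - t) * ES N Y t", OF ab(2)])
  have X: "X \<in> borel_measurable M" and Y: "Y \<in> borel_measurable N"
    using M N by auto
  fix t assume "a \<le> t" "t \<le> b"
  then have t: "0 < t" "t < 1" using ab by auto
  show "0 < (1 - t) * ES M X t" "0 < (1 - t) * ES N Y t"
    using ES_pos[OF M t] ES_pos[OF N t] t by auto
  have v: "0 < VaR M X t" "0 < VaR N Y t"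
    using VaR_pos[OF M(1) X M(3,4) t] VaR_pos[OF N(1) Y N(3,4) t] by auto
  then have "EPS M X t \<le> EPS N Y t"
    using ps t unfolding ps_le_def by auto
  then have "(1 - t) * ES M X t / VaR M X t \<le> (1 - t) * ES N Y t / VaR N Y t"
    using EPS_eq[OF M(1,2) t v(1)] EPS_eq[OF N(1,2) t v(2)] by simp
  then show "VaR N Y t * ((1 - t) * ES M X t) \<le> VaR M X t * ((1 - t) * ES N Y t)"
    using v by (simp add: field_simps)
qed (use tail_integral_diff_bounds[OF M(1,2)] tail_integral_diff_bounds[OF N(1,2)] ab in auto)

section \<open>Comparison of contributions\<close>

text \<open>The stress event reads \<open>p\<close> from index 2 on, so it does not move with the
  integration variable at index 1.\<close>

lemma MCoES_eq: "MCoES n M X p = ES (uniform_measure M (stress_event n M X p)) (X 1) (p 1)"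
proof -
  have "stress_event n M X (p(1 := t)) = stress_event n M X p" for t
    by (auto simp: stress_event_def)
  then show ?thesis
    by (simp add: MCoES_def ES_def MCoVaR_def)
qed

text \<open>The order is applied between (0, p_2, ..., p_n) and (u, p_2, ..., p_n). At first level 0
  the joint tail is the probability of the stress event, since F_1(X_1) > 0 almost surely; the
  monotone ratio then compares the normalised tails at \<open>u\<close>.\<close>

lemma whr_le_conditional_tail:
  assumes n: "n \<ge> 1" and M: "prob_space M" and N: "prob_space N"
    and X: "\<And>i. i \<in> {1..n} \<Longrightarrow> X i \<in> borel_measurable M"
    and Y: "\<And>i. i \<in> {1..n} \<Longrightarrow> Y i \<in> borel_measurable N"
    and contX: "\<And>i. i \<in> {1..n} \<Longrightarrow> continuous_on UNIV (dist_fun M (X i))"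
    and contY: "\<And>i. i \<in> {1..n} \<Longrightarrow> continuous_on UNIV (dist_fun N (Y i))"
    and p: "\<And>i. i \<in> {1..n} \<Longrightarrow> 0 < p i \<and> p i < 1"
    and posX: "measure M (stress_event n M X p) > 0" and posY: "measure N (stress_event n N Y p) > 0"
    and whr: "whr_le n (copula n M X) (copula n N Y)"
    and u: "0 \<le> u" "u \<le> 1"
  shows "measure (uniform_measure M (stress_event n M X p)) {\<omega> \<in> space M. u < dist_fun M (X 1) (X 1 \<omega>)}
    \<le> measure (uniform_measure N (stress_event n N Y p)) {\<omega> \<in> space N. u < dist_fun N (Y 1) (Y 1 \<omega>)}"
proof -
  note One_nat_def [simp del]
  let ?TX = "\<lambda>u. joint_tail n (copula n M X) (p(1 := u))"
  let ?TY = "\<lambda>u. joint_tail n (copula n N Y) (p(1 := u))"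
  have tail: "measure (uniform_measure L (stress_event n L Z p)) {\<omega> \<in> space L. u < dist_fun L (Z 1) (Z 1 \<omega>)}
      = joint_tail n (copula n L Z) (p(1 := u)) / measure L (stress_event n L Z p)"
    and tail0: "joint_tail n (copula n L Z) (p(1 := 0)) = measure L (stress_event n L Z p)"
    if L: "prob_space L" and Z: "\<And>i. i \<in> {1..n} \<Longrightarrow> Z i \<in> borel_measurable L"
      and cont: "\<And>i. i \<in> {1..n} \<Longrightarrow> continuous_on UNIV (dist_fun L (Z i))"
      and pos: "measure L (stress_event n L Z p) > 0"
    for L :: "'c measure" and Z :: "nat \<Rightarrow> 'c \<Rightarrow> real"
  proof -
    interpret L: prob_space L by fact
    have 1: "1 \<in> {1..n}" using n by simp
    note [measurable] = measurable_dist_fun_comp[OF L Z[OF 1] cont[OF 1]]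
    have A [measurable]: "stress_event n L Z p \<in> sets L"
      using Z by (rule measurable_stress_event)
    have sub: "stress_event n L Z p \<subseteq> space L"
      using A by (rule sets.sets_into_space)
    have jt: "joint_tail n (copula n L Z) (p(1 := u)) =
        measure L (stress_event n L Z p \<inter> {\<omega> \<in> space L. u < dist_fun L (Z 1) (Z 1 \<omega>)})" for u
    proof -
      have "stress_event n L Z p \<inter> {\<omega> \<in> space L. u < dist_fun L (Z 1) (Z 1 \<omega>)} =
          {\<omega> \<in> stress_event n L Z p. u < dist_fun L (Z 1) (Z 1 \<omega>)}"
        using sub by auto
      then show ?thesis
        using joint_tail_copula[OF L n Z cont p, where u = u] by simp
    qed
    show "measure (uniform_measure L (stress_event n L Z p)) {\<omega> \<in> space L. u < dist_fun L (Z 1) (Z 1 \<omega>)}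
      = joint_tail n (copula n L Z) (p(1 := u)) / measure L (stress_event n L Z p)"
      using pos by (subst measure_uniform_measure) (auto simp: L.emeasure_eq_measure jt)
    have "measure L (stress_event n L Z p) = measure L (stress_event n L Z p \<inter> {\<omega> \<in> space L. 0 < dist_fun L (Z 1) (Z 1 \<omega>)})"
      using AE_dist_fun_in[OF L Z[OF 1] cont[OF 1]] AE_space
      by (intro L.finite_measure_eq_AE) (auto elim!: eventually_elim2)
    then show "joint_tail n (copula n L Z) (p(1 := 0)) = measure L (stress_event n L Z p)"
      by (simp add: jt)
  qed
  have tX: "measure (uniform_measure M (stress_event n M X p)) {\<omega> \<in> space M. u < dist_fun M (X 1) (X 1 \<omega>)}
      = ?TX u / measure M (stress_event n M X p)"
    "?TX 0 = measure M (stress_event n M X p)"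
    by (rule tail[OF M X contX posX] tail0[OF M X contX posX]; assumption)+
  have tY: "measure (uniform_measure N (stress_event n N Y p)) {\<omega> \<in> space N. u < dist_fun N (Y 1) (Y 1 \<omega>)}
      = ?TY u / measure N (stress_event n N Y p)"
    "?TY 0 = measure N (stress_event n N Y p)"
    by (rule tail[OF N Y contY posY] tail0[OF N Y contY posY]; assumption)+
  show ?thesis
  \<comment> \<open>A vanishing tail at \<open>u\<close> lies outside the domain of the ratio, but
    then the left side is zero.\<close>
  proof (cases "?TX u > 0")
    case True
    have "(\<forall>i\<in>{1..n}. 0 \<le> (p(1 := 0)) i \<and> (p(1 := 0)) i \<le> (p(1 := u)) i \<and> (p(1 := u)) i \<le> 1) \<and>
        0 < ?TX 0 \<and> 0 < ?TX u"
      using p u True posX tX(2) by (auto intro: less_imp_le)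
    then have "?TY 0 / ?TX 0 \<le> ?TY u / ?TX u"
      using whr unfolding whr_le_def by blast
    then show ?thesis
      using True posX posY unfolding tX tY by (simp add: field_simps)
  next
    case False
    then have "?TX u / measure M (stress_event n M X p) \<le> 0"
      using posX by (simp add: divide_le_0_iff)
    also have "0 \<le> ?TY u / measure N (stress_event n N Y p)"
      by (simp add: joint_tail_def)
    finally show ?thesis
      unfolding tX tY .
  qed
qed

text \<open>The vector \<open>X\<close> provides the stressed law of \<open>U\<close>, while the two
  quantile functions come from \<open>V\<close> and \<open>W\<close> on spaces of their own. In this
  form the lemma serves whichever of the two vectors is stochastically increasing.\<close>

lemma SI_ES_ratio_le:
  fixes X :: "nat \<Rightarrow> 'a \<Rightarrow> real"
  assumes n: "n \<ge> 1" and M: "prob_space M"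
    and X: "\<And>i. i \<in> {1..n} \<Longrightarrow> X i \<in> borel_measurable M"
    and cont: "continuous_on UNIV (dist_fun M (X 1))"
    and SI: "SI_in_first n M X"
    and pos: "measure M (stress_event n M X p) > 0"
    and V: "prob_space K" "integrable K V" "continuous_on UNIV (dist_fun K V)" "AE \<omega> in K. 0 \<le> V \<omega>"
    and W: "prob_space L" "integrable L W" "continuous_on UNIV (dist_fun L W)" "AE \<omega> in L. 0 \<le> W \<omega>"
    and ps: "ps_le K V L W" and p: "0 < p1" "p1 < 1"
  defines "Q \<equiv> uniform_measure M (stress_event n M X p)"
    and "U \<equiv> \<lambda>\<omega>. dist_fun M (X 1) (X 1 \<omega>)"
  shows "ES Q (\<lambda>\<omega>. quantile_fun K V (U \<omega>)) p1 * ES L W p1 \<le> ES Q (\<lambda>\<omega>. quantile_fun L W (U \<omega>)) p1 * ES K V p1"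
proof -
  note One_nat_def [simp del]
  have X1 [measurable]: "X 1 \<in> borel_measurable M" using X n by auto
  have Vm: "V \<in> borel_measurable K" and Wm: "W \<in> borel_measurable L" using V W by auto
  obtain h where h: "mono h" "\<And>x. 0 \<le> h x"
    "\<And>g :: real \<Rightarrow> ennreal. g \<in> borel_measurable borel \<Longrightarrow>
      (\<integral>\<^sup>+ \<omega>. g (X 1 \<omega>) * indicator (stress_event n M X p) \<omega> \<partial>M) =
      (\<integral>\<^sup>+ \<omega>. g (X 1 \<omega>) * ennreal (h (X 1 \<omega>)) \<partial>M)"
    using SI_density[OF M X n SI] by blast
  note [measurable] = measurable_quantile_fun[OF M X1] borel_measurable_mono[OF h(1)]
    measurable_dist_fun[OF M X1]
  have U [measurable]: "U \<in> borel_measurable M"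
    unfolding U_def by measurable
  \<comment> \<open>The density in terms of \<open>X 1\<close> becomes a density in terms of
    \<open>U\<close>, because the quantile function recovers \<open>X 1\<close> from
    \<open>U\<close> almost surely.\<close>
  define k where "k t = h (quantile_fun M (X 1) t)" for t
  have [measurable]: "k \<in> borel_measurable borel"
    unfolding k_def by measurable
  have mono_q: "mono_on {0<..<1} (quantile_fun R Z)" if "prob_space R" "Z \<in> borel_measurable R"
    for R :: "'z measure" and Z
    using VaR_mono[OF that] by (auto simp: mono_on_def quantile_fun_def)
  have nonneg_q: "0 \<le> quantile_fun R Z t"
    if "prob_space R" "Z \<in> borel_measurable R" "continuous_on UNIV (dist_fun R Z)" "AE \<omega> in R. 0 \<le> Z \<omega>"
    for R :: "'z measure" and Z t
    using VaR_pos[OF that, of t] by (auto simp: quantile_fun_def intro: less_imp_le)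
  let ?S = "\<lambda>R Z s. \<integral>t. indicator {s<..} t * quantile_fun R Z t \<partial>unit_unif"
  have "ES Q (\<lambda>\<omega>. quantile_fun K V (U \<omega>)) p1 * ?S L W p1 \<le> ES Q (\<lambda>\<omega>. quantile_fun L W (U \<omega>)) p1 * ?S K V p1"
    unfolding Q_def
  proof (rule ES_increasing_density_ratio[OF M U _ _ pos _ _ _ _ _ _ _ _ _ _ p])
    show "distr M borel U = unit_unif"
      unfolding U_def using distr_dist_fun[OF M X1 cont] .
    show "stress_event n M X p \<in> sets M"
      using X by (rule measurable_stress_event)
    show "mono_on {0<..<1} k"
      using mono_q[OF M X1] h(1) by (auto simp: k_def mono_on_def dest: monoD)
    show "0 \<le> k t" for t using h(2) by (simp add: k_def)
    show "integrable unit_unif (quantile_fun K V)" "integrable unit_unif (quantile_fun L W)"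
      using integrable_quantile_fun[OF V(1) Vm] integrable_quantile_fun[OF W(1) Wm] V W by auto
    show "mono_on {0<..<1} (quantile_fun K V)" "mono_on {0<..<1} (quantile_fun L W)"
      using mono_q V(1) Vm W(1) Wm by auto
    show "0 \<le> quantile_fun K V t" "0 \<le> quantile_fun L W t" for t
      using nonneg_q V(1) Vm V(3,4) W(1) Wm W(3,4) by auto
    show "0 < ?S L W p1"
      using ES_pos[OF W p] p ES_eq_integral[OF W(1) Wm, of p1]
      by (metis diff_gt_0_iff_gt less_imp_le mult_pos_pos)
    show "?S K V s * ?S L W p1 \<le> ?S L W s * ?S K V p1" if s: "p1 \<le> s" "s < 1" for s
    proof -
      have "0 \<le> s" "0 \<le> p1" using s p by auto
      then show ?thesis
        unfolding mult.commute[of "?S K V s"] using s p ps_le_tail_ratio_mono[OF V W ps p(1) s]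
        by (simp only: ES_eq_integral[OF V(1) Vm, symmetric] ES_eq_integral[OF W(1) Wm, symmetric])
    qed
    fix g :: "real \<Rightarrow> ennreal" assume [measurable]: "g \<in> borel_measurable borel"
    have "(\<integral>\<^sup>+ \<omega>. g (U \<omega>) * indicator (stress_event n M X p) \<omega> \<partial>M) =
        (\<integral>\<^sup>+ \<omega>. g (dist_fun M (X 1) (X 1 \<omega>)) * ennreal (h (X 1 \<omega>)) \<partial>M)"
      unfolding U_def by (rule h(3)) measurable
    also have "\<dots> = (\<integral>\<^sup>+ \<omega>. g (U \<omega>) * ennreal (k (U \<omega>)) \<partial>M)"
    proof (rule nn_integral_cong_AE)
      show "AE \<omega> in M. g (dist_fun M (X 1) (X 1 \<omega>)) * ennreal (h (X 1 \<omega>)) = g (U \<omega>) * ennreal (k (U \<omega>))"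
        using AE_quantile_dist_fun[OF M X1 cont] by eventually_elim (simp add: U_def k_def)
    qed
    also have "\<dots> = (\<integral>\<^sup>+ t. g t * ennreal (k t) \<partial>distr M borel U)"
      by (simp add: nn_integral_distr)
    also have "distr M borel U = unit_unif"
      unfolding U_def using distr_dist_fun[OF M X1 cont] .
    finally show "(\<integral>\<^sup>+ \<omega>. g (U \<omega>) * indicator (stress_event n M X p) \<omega> \<partial>M) = (\<integral>\<^sup>+ t. g t * ennreal (k t) \<partial>unit_unif)" .
  qed measurable
  then have "ES Q (\<lambda>\<omega>. quantile_fun K V (U \<omega>)) p1 * ((1 - p1) * ES L W p1) \<le>
      ES Q (\<lambda>\<omega>. quantile_fun L W (U \<omega>)) p1 * ((1 - p1) * ES K V p1)"
    unfolding ES_eq_integral[OF V(1) Vm less_imp_le[OF p(1)] p(2)]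
      ES_eq_integral[OF W(1) Wm less_imp_le[OF p(1)] p(2)] .
  then have "(1 - p1) * (ES Q (\<lambda>\<omega>. quantile_fun K V (U \<omega>)) p1 * ES L W p1) \<le>
      (1 - p1) * (ES Q (\<lambda>\<omega>. quantile_fun L W (U \<omega>)) p1 * ES K V p1)"
    by (simp add: mult_ac)
  then show ?thesis
    using p by (subst (asm) mult_le_cancel_left_pos) auto
qed

theorem theorem3p6:
  fixes M :: "'a measure" and N :: "'b measure"
    and X :: "nat \<Rightarrow> 'a \<Rightarrow> real" and Y :: "nat \<Rightarrow> 'b \<Rightarrow> real"
    and f g :: "(nat \<Rightarrow> real) \<Rightarrow> ennreal"
    and n :: nat and p :: "nat \<Rightarrow> real"
  assumes "n \<ge> 2"
    and "prob_space M" and "prob_space N"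
    and "\<And>i. i \<in> {1..n} \<Longrightarrow> X i \<in> borel_measurable M"
    and "\<And>i. i \<in> {1..n} \<Longrightarrow> Y i \<in> borel_measurable N"
    and "\<And>i. i \<in> {1..n} \<Longrightarrow> AE \<omega> in M. X i \<omega> \<ge> 0"
    and "\<And>i. i \<in> {1..n} \<Longrightarrow> AE \<omega> in N. Y i \<omega> \<ge> 0"
    and "distributed M (PiM {1..n} (\<lambda>_. lborel)) (rvec {1..n} X) f"
    and "distributed N (PiM {1..n} (\<lambda>_. lborel)) (rvec {1..n} Y) g"
    and "\<And>i. i \<in> {1..n} \<Longrightarrow> continuous_on UNIV (dist_fun M (X i))"
    and "\<And>i. i \<in> {1..n} \<Longrightarrow> continuous_on UNIV (dist_fun N (Y i))"
    and "\<And>i. i \<in> {1..n} \<Longrightarrow> integrable M (X i)"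
    and "\<And>i. i \<in> {1..n} \<Longrightarrow> integrable N (Y i)"
    and "whr_le n (copula n M X) (copula n N Y)"
    and "SI_in_first n M X \<or> SI_in_first n N Y"
    and "\<And>i. i \<in> {1..n} \<Longrightarrow> 0 < p i \<and> p i < 1"
    and "measure M (stress_event n M X p) > 0"
    and "measure N (stress_event n N Y p) > 0"
    and "ps_le M (X 1) N (Y 1)"
  shows "Delta_R_MCoES n M X p \<le> Delta_R_MCoES n N Y p"
proof -
  note One_nat_def [simp del]
  note M = assms(2) and N = assms(3)
  interpret M: prob_space M by fact
  interpret N: prob_space N by fact
  have n: "1 \<le> n" and 1: "1 \<in> {1..n}" using assms(1) by auto
  note X1 [measurable] = assms(4)[OF 1] and Y1 [measurable] = assms(5)[OF 1]
    and X1_nn = assms(6)[OF 1] and Y1_nn = assms(7)[OF 1]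
    and contX = assms(10)[OF 1] and contY = assms(11)[OF 1]
    and intX = assms(12)[OF 1] and intY = assms(13)[OF 1]
  have p: "0 < p 1" "p 1 < 1" using assms(16)[OF 1] by auto
  define A where "A = stress_event n M X p"
  define A' where "A' = stress_event n N Y p"
  define Q where "Q = uniform_measure M A"
  define R where "R = uniform_measure N A'"
  define U where "U \<omega> = dist_fun M (X 1) (X 1 \<omega>)" for \<omega>
  define V where "V \<omega> = dist_fun N (Y 1) (Y 1 \<omega>)" for \<omega>
  define q where "q = quantile_fun M (X 1)"
  define r where "r = quantile_fun N (Y 1)"
  have [measurable]: "A \<in> sets M" "A' \<in> sets N"
    unfolding A_def A'_def using assms(4,5) by (auto intro: measurable_stress_event)
  have A_pos: "emeasure M A \<noteq> 0" "emeasure N A' \<noteq> 0"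
    using assms(17,18) by (auto simp: A_def A'_def M.emeasure_eq_measure N.emeasure_eq_measure)
  have Q: "prob_space Q" and R: "prob_space R"
    unfolding Q_def R_def using A_pos by (auto intro: prob_space_uniform_measure)
  have [measurable_cong, simp]: "sets Q = sets M" "sets R = sets N"
    and [simp]: "space Q = space M" "space R = space N"
    by (auto simp: Q_def R_def)
  have UM [measurable]: "U \<in> borel_measurable M" and VN [measurable]: "V \<in> borel_measurable N"
    using measurable_dist_fun_comp[OF M X1 contX] measurable_dist_fun_comp[OF N Y1 contY]
    by (auto simp: U_def[abs_def] V_def[abs_def])
  have [measurable]: "q \<in> borel_measurable borel" "r \<in> borel_measurable borel"
    unfolding q_def r_def by (rule measurable_quantile_fun[OF M X1], rule measurable_quantile_fun[OF N Y1])
  have in01: "AE \<omega> in Q. 0 < U \<omega> \<and> U \<omega> < 1" "AE \<omega> in R. 0 < V \<omega> \<and> V \<omega> < 1"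
    unfolding Q_def R_def U_def V_def
    using AE_dist_fun_in[OF M X1 contX] AE_dist_fun_in[OF N Y1 contY]
    by (auto intro!: AE_uniform_measure_of_AE)
  have distr_U: "distr M borel U = unit_unif" and distr_V: "distr N borel V = unit_unif"
    unfolding U_def[abs_def] V_def[abs_def]
    using distr_dist_fun[OF M X1 contX] distr_dist_fun[OF N Y1 contY] .
  have iq: "integrable unit_unif q" and ir: "integrable unit_unif r"
    unfolding q_def r_def using integrable_quantile_fun M N X1 Y1 intX intY by blast+
  have int_Q: "integrable Q (\<lambda>\<omega>. k (U \<omega>))" and int_R: "integrable R (\<lambda>\<omega>. k (V \<omega>))"
    if k: "integrable unit_unif k" for k :: "real \<Rightarrow> real"
  proof -
    have [measurable]: "k \<in> borel_measurable borel" using k by auto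
    have "integrable M (\<lambda>\<omega>. k (U \<omega>))" "integrable N (\<lambda>\<omega>. k (V \<omega>))"
      using k integrable_distr_eq[of U M borel k] integrable_distr_eq[of V N borel k]
      by (simp_all add: distr_U distr_V)
    then show "integrable Q (\<lambda>\<omega>. k (U \<omega>))" "integrable R (\<lambda>\<omega>. k (V \<omega>))"
      unfolding Q_def R_def using A_pos by (auto intro: integrable_uniform_measure)
  qed
  have tail: "measure Q {\<omega> \<in> space Q. u < U \<omega>} \<le> measure R {\<omega> \<in> space R. u < V \<omega>}"
    if "0 \<le> u" "u \<le> 1" for u
    using whr_le_conditional_tail[OF n M N assms(4,5,10,11,16,17,18,14) that]
    by (simp add: Q_def R_def A_def A'_def U_def V_def)
  \<comment> \<open>Writing \<open>X 1\<close> as q(U) separates the marginal quantile function from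
    the stressed law of \<open>U\<close>, so that each can be exchanged on its own.\<close>
  have MX: "MCoES n M X p = ES Q (\<lambda>\<omega>. q (U \<omega>)) (p 1)"
  proof -
    have "AE \<omega> in Q. X 1 \<omega> = q (U \<omega>)"
      unfolding Q_def q_def U_def using AE_quantile_dist_fun[OF M X1 contX]
      by (intro AE_uniform_measure_of_AE) (auto simp: eq_commute)
    then show ?thesis
      unfolding MCoES_eq Q_def[symmetric] A_def[symmetric] by (intro ES_cong_AE) auto
  qed
  have MY: "MCoES n N Y p = ES R (\<lambda>\<omega>. r (V \<omega>)) (p 1)"
  proof -
    have "AE \<omega> in R. Y 1 \<omega> = r (V \<omega>)"
      unfolding R_def r_def V_def using AE_quantile_dist_fun[OF N Y1 contY]
      by (intro AE_uniform_measure_of_AE) (auto simp: eq_commute)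
    then show ?thesis
      unfolding MCoES_eq R_def[symmetric] A'_def[symmetric] by (intro ES_cong_AE) auto
  qed
  have mono_q: "ES Q (\<lambda>\<omega>. q (U \<omega>)) (p 1) \<le> ES R (\<lambda>\<omega>. q (V \<omega>)) (p 1)"
    unfolding q_def
    by (rule ES_quantile_comp_mono[OF M X1 Q R _ _ in01 _ _ tail p])
       (use int_Q[OF iq] int_R[OF iq] in \<open>auto simp: q_def\<close>)
  have mono_r: "ES Q (\<lambda>\<omega>. r (U \<omega>)) (p 1) \<le> ES R (\<lambda>\<omega>. r (V \<omega>)) (p 1)"
    unfolding r_def
    by (rule ES_quantile_comp_mono[OF N Y1 Q R _ _ in01 _ _ tail p])
       (use int_Q[OF ir] int_R[OF ir] in \<open>auto simp: r_def\<close>)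
  have ES_X: "0 < ES M (X 1) (p 1)" and ES_Y: "0 < ES N (Y 1) (p 1)"
    using ES_pos[OF M intX contX X1_nn p] ES_pos[OF N intY contY Y1_nn p] .
  \<comment> \<open>\<open>Delta_R_MCoES\<close> is the quotient of MCoES and ES minus 1; as both ES
    are positive, the claim is this cross-multiplied inequality.\<close>
  have "MCoES n M X p * ES N (Y 1) (p 1) \<le> MCoES n N Y p * ES M (X 1) (p 1)"
    using assms(15)
  proof
    \<comment> \<open>The increasing density is available under \<open>Q\<close>, so the quantile
      function is exchanged first, under \<open>Q\<close>, and the law afterwards, for
      \<open>r\<close>.\<close>
    assume "SI_in_first n M X"
    from SI_ES_ratio_le[OF n M assms(4) contX this assms(17) M intX contX X1_nn N intY contY Y1_nn assms(19) p]
    have "MCoES n M X p * ES N (Y 1) (p 1) \<le> ES Q (\<lambda>\<omega>. r (U \<omega>)) (p 1) * ES M (X 1) (p 1)"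
      by (simp add: MX Q_def A_def U_def q_def r_def)
    also have "\<dots> \<le> MCoES n N Y p * ES M (X 1) (p 1)"
      unfolding MY using mono_r ES_X by (intro mult_right_mono) auto
    finally show ?thesis .
  next
    \<comment> \<open>Now the increasing density lives under \<open>R\<close>: the law is exchanged
      for \<open>q\<close>, and the quantile function is exchanged under \<open>R\<close>.\<close>
    assume "SI_in_first n N Y"
    from SI_ES_ratio_le[OF n N assms(5) contY this assms(18) M intX contX X1_nn N intY contY Y1_nn assms(19) p]
    have "ES R (\<lambda>\<omega>. q (V \<omega>)) (p 1) * ES N (Y 1) (p 1) \<le> MCoES n N Y p * ES M (X 1) (p 1)"
      by (simp add: MY R_def A'_def V_def q_def r_def)
    moreover have "MCoES n M X p * ES N (Y 1) (p 1) \<le> ES R (\<lambda>\<omega>. q (V \<omega>)) (p 1) * ES N (Y 1) (p 1)"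
      unfolding MX using mono_q ES_Y by (intro mult_right_mono) auto
    ultimately show ?thesis by linarith
  qed
  then have "MCoES n M X p / ES M (X 1) (p 1) \<le> MCoES n N Y p / ES N (Y 1) (p 1)"
    using ES_X ES_Y by (simp add: field_simps)
  then show ?thesis
    using ES_X ES_Y by (simp add: Delta_R_MCoES_def diff_divide_distrib)
qed

end
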